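(* In the setting described in the context, let $\{(\bm{u}_h^n,\xi_h^n,p_h^n)\}_{n=2}^N$ be the solution of the monolithic BDF-2 scheme, and for $i\ge1$ let $p_{h,r}^{n,i}$, $(\tilde{\bm{u}}_h^{n,i},\tilde\xi_h^{n,i})$ and $(\bm{u}_{h,r}^{n,i},\xi_{h,r}^{n,i})$ be the quantities generated by the ROM-based global-in-time iterative decoupled BDF-2 algorithm with index set $\bm{\Lambda}$ and reduced basis size $N_r<\#(\bm{\Lambda})$, with the same data at the time levels $n=0,1$. Define $e_{\bm{u},r}^{n,i}:=\bm{u}_{h,r}^{n,i}-\bm{u}_h^n$, $e_{\xi,r}^{n,i}:=\xi_{h,r}^{n,i}-\xi_h^n$, $e_{p,r}^{n,i}:=p_{h,r}^{n,i}-p_h^n$ (all taken to be zero for $n=0,1$), and let $$\epsilon_{ROM}^i(\bm{\Lambda},N_r):=\max_{2\le n\le N}\|\xi_{h,r}^{n,i}-\tilde\xi_h^{n,i}\|_{L^2}^2,\qquad i\ge1,$$ which measures the reduced order modeling error at the $i$-th iteration and is determined by the selected index set $\bm{\Lambda}$ and reduced basis size $N_r$. Let $$K=\frac{1}{\left(\frac{c_0\lambda}{\alpha^2}+1\right)\left(C(\tilde\beta,\mu)\lambda+1\right)},$$ where $C(\tilde\beta,\mu)>0$ is a constant depending on $\tilde\beta$ and $\mu$. Then there are constants $C_1,C_2$ depending on $K$, $N$ and $\Delta t$ for which the following hold. (1) For all $i\ge1$, $$\sum_{n=2}^N\|\mathbb{D}_t^2e_{\xi,r}^{n,i}\|_{L^2}^2\le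 C_1\,\epsilon_{ROM}^i(\bm{\Lambda},N_r)+\frac{1+K^2}{2}\sum_{n=2}^N\|\mathbb{D}_t^2e_{\xi,r}^{n,i-1}\|_{L^2}^2 .$$ (2) Assuming the existence of an upper bound $\epsilon_{ROM}(\bm{\Lambda},N_r):=\max_{i\ge1}\epsilon_{ROM}^i(\bm{\Lambda},N_r)$, it follows that $$\lim_{i\to\infty}\sum_{n=2}^N\|\mathbb{D}_t^2e_{\xi,r}^{n,i}\|_{L^2}^2\le C_2\,\epsilon_{ROM}(\bm{\Lambda},N_r).$$
   Context: **Domain and parameters.** $\Omega\subset\mathbb{R}^d$ ($d=2$ or $3$) is a bounded polygonal (polyhedral) domain, with $\partial\Omega=\Gamma_u\cup\Gamma_\sigma=\Gamma_p\cup\Gamma_q$, $\Gamma_u\cap\Gamma_\sigma=\emptyset$, $\Gamma_p\cap\Gamma_q=\emptyset$, all four parts having positive measure. Parameters: $\lambda,\mu,\alpha,k_p>0$ and $c_0\ge0$. $T<\infty$ is the final time; $\bm{f}$ and $g$ are given, sufficiently regular functions on $\Omega\times[0,T]$. $(\cdot,\cdot)$ is the $L^2(\Omega)$ inner product, $(\cdot,\cdot)_1$ the $H^1(\Omega)$ inner product, and $\varepsilon(\bm{u})=\frac12[\nabla\bm{u}+(\nabla\bm{u})^T]$. **Bilinear forms.** $a_1(\bm{u},\bm{v})=2\mu\int_\Omega\varepsilon(\bm{u}):\varepsilon(\bm{v})$, $b(\bm{v},w)=\int_\Omega w\,\nabla\cdot\bm{v}$, $a_2(\xi,w)=\frac1\lambda\int_\Omega\xi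 w$, $c(p,w)=\frac\alpha\lambda\int_\Omega pw$, $a_3(p,q)=\left(c_0+\frac{\alpha^2}{\lambda}\right)\int_\Omega pq$, $d(p,q)=k_p\int_\Omega\nabla p\cdot\nabla q$. **Discrete spaces.** $\mathcal{T}_h$ is a mesh of $\Omega$ by triangles/tetrahedra with maximum element diameter $h$; $k\ge2$ and $l\ge1$ are integers. $\bm{V}_h=\{\bm{v}_h\in [H^1(\Omega)]^d\cap [C^0(\bar\Omega)]^d:\bm{v}_h|_{\Gamma_u}=\bm{0},\ \bm{v}_h|_E\in[P_k(E)]^d\ \forall E\in\mathcal{T}_h\}$, $W_h=\{w_h\in L^2(\Omega)\cap C^0(\bar\Omega):w_h|_E\in P_{k-1}(E)\ \forall E\in\mathcal{T}_h\}$, $M_h=\{q_h\in H^1(\Omega)\cap C^0(\bar\Omega):q_h|_{\Gamma_p}=0,\ q_h|_E\in P_l(E)\ \forall E\in\mathcal{T}_h\}$. The discrete inf-sup condition holds: there is $\tilde\beta>0$ independent of $h$ with $\sup_{\bm{0}\ne\bm{v}_h\in\bm{V}_h} b(\bm{v}_h,w_h)/\|\bm{v}_h\|_{H^1}\ge\tilde\beta\|w_h\|_{L^2}$ for all $w_h\in W_h$. **Time discretization.** $\Delta t=T/N$, $t^n=n\Delta t$, $\bm{f}^n=\bm{f}(t^n)$, $g^n=g(t^n)$, and $\mathbb{D}_t^2y^n=\frac1{\Delta t}\left(\frac32y^n-2y^{n-1}+\frac12y^{n-2}\right)$. For doubly indexed sequences $y^{n,i}$, $\mathbb{D}_t^2$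 acts on the time index $n$ with $i$ fixed. **Monolithic BDF-2 scheme.** Given $\xi_h^0,\xi_h^1\in W_h$ and $p_h^0,p_h^1\in M_h$, for $n=2,\dots,N$ find $(\bm{u}_h^n,\xi_h^n,p_h^n)\in\bm{V}_h\times W_h\times M_h$ such that for all $(\bm{v}_h,w_h,q_h)\in\bm{V}_h\times W_h\times M_h$: $a_1(\bm{u}_h^n,\bm{v}_h)-b(\bm{v}_h,\xi_h^n)=(\bm{f}^n,\bm{v}_h)$, $b(\bm{u}_h^n,w_h)+a_2(\xi_h^n,w_h)-c(p_h^n,w_h)=0$, $a_3(\mathbb{D}_t^2p_h^n,q_h)-c(q_h,\mathbb{D}_t^2\xi_h^n)+d(p_h^n,q_h)=(g^n,q_h)$. **POD.** Given snapshots $\phi^1,\dots,\phi^L$ in a real inner product space, form the correlation matrix $\mathbf{C}\in\mathbb{R}^{L\times L}$ whose entries are the pairwise inner products of the snapshots. It is taken to be symmetric positive definite, with eigenvalues $\gamma_1\ge\dots\ge\gamma_L>0$ and corresponding orthonormal eigenvectors $v_1,\dots,v_L\in\mathbb{R}^L$. The $n$-th POD mode is $\varphi_n=\gamma_n^{-1/2}\sum_{\beta=1}^L[v_n]_\beta\phi^\beta$, and $\mathrm{POD}(\{\phi^\beta\};N_r)=\mathrm{span}(\varphi_1,\dots,\varphi_{N_r})$. The inner product used is $(\cdot,\cdot)_1$ for displacement snapshots and $(\cdot,\cdot)$ for total pressure snapshots. **ROM-based global-in-time iterative decoupled BDF-2 algorithm.** The index set $\bm{\Lambda}$ selects distinct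 time indices $\Lambda_1,\dots,\Lambda_{\#(\bm{\Lambda})}\in\{2,\dots,N\}$, where $\#(\bm{\Lambda})$ is its size; $N_r<\#(\bm{\Lambda})$. Given initial guesses $\{\xi_{h,r}^{n,0}\}_{n=2}^N\subset W_h$, for $i=1,2,\dots$ set $p_{h,r}^{n,i}=p_h^n$ and $\xi_{h,r}^{n,i-1}=\xi_h^n$ for $n=0,1$, and perform: Step a: find $\{p_{h,r}^{n,i}\}_{n=2}^N\subset M_h$ with $a_3(\mathbb{D}_t^2p_{h,r}^{n,i},q_h)+d(p_{h,r}^{n,i},q_h)=(g^n,q_h)+c(q_h,\mathbb{D}_t^2\xi_{h,r}^{n,i-1})$ for all $q_h\in M_h$. Step b: let $(\tilde{\bm{u}}_h^{n,i},\tilde\xi_h^{n,i})\in\bm{V}_h\times W_h$ solve $a_1(\tilde{\bm{u}}_h^{n,i},\bm{v}_h)-b(\bm{v}_h,\tilde\xi_h^{n,i})=(\bm{f}^n,\bm{v}_h)$ for all $\bm{v}_h\in\bm{V}_h$ and $b(\tilde{\bm{u}}_h^{n,i},w_h)+a_2(\tilde\xi_h^{n,i},w_h)=c(p_{h,r}^{n,i},w_h)$ for all $w_h\in W_h$. The algorithm computes these only for the indices $n$ selected by $\bm{\Lambda}$ (the snapshots), but they are defined by these equations for every $n=2,\dots,N$ for the purpose of the analysis, with $\tilde\xi_h^{n,i}:=\xi_h^n$ for $n=0,1$. Step c: set $\bm{V}_{h,r}^i=\mathrm{POD}(\{\tilde{\bm{u}}_h^{\Lambda_n,i}\}_n;N_r)$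 and $W_{h,r}^i=\mathrm{POD}(\{\tilde\xi_h^{\Lambda_n,i}\}_n;N_r)$, and for $n=2,\dots,N$ find $(\bm{u}_{h,r}^{n,i},\xi_{h,r}^{n,i})\in\bm{V}_{h,r}^i\times W_{h,r}^i$ with $a_1(\bm{u}_{h,r}^{n,i},\bm{v}_{h,r})-b(\bm{v}_{h,r},\xi_{h,r}^{n,i})=(\bm{f}^n,\bm{v}_{h,r})$ for all $\bm{v}_{h,r}\in\bm{V}_{h,r}^i$ and $b(\bm{u}_{h,r}^{n,i},w_{h,r})+a_2(\xi_{h,r}^{n,i},w_{h,r})=c(p_{h,r}^{n,i},w_{h,r})$ for all $w_{h,r}\in W_{h,r}^i$. *)

theory Defs
  imports "HOL-Analysis.Analysis"
begin

section \<open>Domain, boundary and mesh\<close>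

text \<open>The Hausdorff measure without its normalising constant, so only its vanishing or positivity
  is meaningful. The covering sets must be bounded because \<^const>\<open>diameter\<close> is a junk value
  on unbounded sets. Only used for \<^term>\<open>s \<ge> 1\<close>.\<close>

definition hausdorff_measure :: "nat \<Rightarrow> 'a::metric_space set \<Rightarrow> ennreal" where
  "hausdorff_measure s A =
     (SUP \<delta>\<in>{0::real<..}.
        INF U\<in>{U :: nat \<Rightarrow> 'a set. A \<subseteq> (\<Union>i. U i) \<and> (\<forall>i. bounded (U i) \<and> diameter (U i) \<le> \<delta>)}.
          (\<Sum>i. ennreal (diameter (U i) ^ s)))"

definition polyhedral_domain :: "(real^'d) set \<Rightarrow> bool" where
  "polyhedral_domain \<Omega> \<longleftrightarrow>
     open \<Omega> \<and> connected \<Omega> \<and> bounded \<Omega> \<and> \<Omega> \<noteq> {} \<and>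
     (\<exists>F. finite F \<and> (\<forall>P\<in>F. polytope P \<and> aff_dim P = int CARD('d) - 1) \<and> frontier \<Omega> = \<Union>F)"

definition boundary_partition :: "(real^'d) set \<Rightarrow> (real^'d) set \<Rightarrow> (real^'d) set \<Rightarrow> bool" where
  "boundary_partition \<Omega> \<Gamma>1 \<Gamma>2 \<longleftrightarrow>
     frontier \<Omega> = \<Gamma>1 \<union> \<Gamma>2 \<and> \<Gamma>1 \<inter> \<Gamma>2 = {} \<and>
     0 < hausdorff_measure (CARD('d) - 1) \<Gamma>1 \<and> 0 < hausdorff_measure (CARD('d) - 1) \<Gamma>2"

definition simplicial_mesh :: "(real^'d) set \<Rightarrow> (real^'d) set set \<Rightarrow> bool" where
  "simplicial_mesh \<Omega> \<T> \<longleftrightarrow>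
     triangulation \<T> \<and> (\<forall>E\<in>\<T>. int CARD('d) simplex E) \<and> \<Union>\<T> = closure \<Omega>"

section \<open>Lebesgue and Sobolev spaces\<close>

text \<open>Elements of the function spaces are total functions; membership depends only on the values
  on \<open>\<Omega>\<close> (on its closure for the finite element spaces below).\<close>

definition L2 :: "'a::euclidean_space set \<Rightarrow> ('a \<Rightarrow> 'b::euclidean_space) set" where
  "L2 \<Omega> = {u. u \<in> borel_measurable (lebesgue_on \<Omega>) \<and>
               integrable (lebesgue_on \<Omega>) (\<lambda>x. (norm (u x))\<^sup>2)}"

definition l2_inner :: "'a::euclidean_space set \<Rightarrow> ('a \<Rightarrow> 'b::euclidean_space) \<Rightarrow> ('a \<Rightarrow> 'b) \<Rightarrow> real" where
  "l2_inner \<Omega> u v = (LINT x|lebesgue_on \<Omega>. u x \<bullet> v x)"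

definition l2_norm :: "'a::euclidean_space set \<Rightarrow> ('a \<Rightarrow> 'b::euclidean_space) \<Rightarrow> real" where
  "l2_norm \<Omega> u = sqrt (l2_inner \<Omega> u u)"

definition partial_deriv :: "'d \<Rightarrow> (real^'d \<Rightarrow> real) \<Rightarrow> real^'d \<Rightarrow> real" where
  "partial_deriv j \<phi> x = frechet_derivative \<phi> (at x) (axis j 1)"

primrec Ck :: "nat \<Rightarrow> (real^'d \<Rightarrow> real) \<Rightarrow> bool" where
  "Ck 0 \<phi> \<longleftrightarrow> continuous_on UNIV \<phi>"
| "Ck (Suc m) \<phi> \<longleftrightarrow> (\<forall>x. \<phi> differentiable (at x)) \<and> (\<forall>j. Ck m (partial_deriv j \<phi>))"

definition test_functions :: "(real^'d) set \<Rightarrow> (real^'d \<Rightarrow> real) set" where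
  "test_functions \<Omega> =
     {\<phi>. (\<forall>m. Ck m \<phi>) \<and> compact (closure {x. \<phi> x \<noteq> 0}) \<and> closure {x. \<phi> x \<noteq> 0} \<subseteq> \<Omega>}"

definition is_weak_grad :: "(real^'d) set \<Rightarrow> (real^'d \<Rightarrow> real) \<Rightarrow> (real^'d \<Rightarrow> real^'d) \<Rightarrow> bool" where
  "is_weak_grad \<Omega> u G \<longleftrightarrow>
     (\<forall>\<phi>\<in>test_functions \<Omega>. \<forall>j.
        (LINT x|lebesgue_on \<Omega>. u x * partial_deriv j \<phi> x) = - (LINT x|lebesgue_on \<Omega>. G x $ j * \<phi> x))"

definition H1 :: "(real^'d) set \<Rightarrow> (real^'d \<Rightarrow> real) set" where
  "H1 \<Omega> = {u \<in> L2 \<Omega>. \<exists>G\<in>L2 \<Omega>. is_weak_grad \<Omega> u G}"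

text \<open>The weak gradient is determined almost everywhere only; one representative is chosen.\<close>

definition wgrad :: "(real^'d) set \<Rightarrow> (real^'d \<Rightarrow> real) \<Rightarrow> real^'d \<Rightarrow> real^'d" where
  "wgrad \<Omega> u = (SOME G. G \<in> L2 \<Omega> \<and> is_weak_grad \<Omega> u G)"

definition H1v :: "(real^'d) set \<Rightarrow> (real^'d \<Rightarrow> real^'d) set" where
  "H1v \<Omega> = {v. \<forall>i. (\<lambda>x. v x $ i) \<in> H1 \<Omega>}"

definition wjac :: "(real^'d) set \<Rightarrow> (real^'d \<Rightarrow> real^'d) \<Rightarrow> real^'d \<Rightarrow> real^'d^'d" where
  "wjac \<Omega> v x = (\<chi> i. wgrad \<Omega> (\<lambda>y. v y $ i) x)"

definition strain :: "(real^'d) set \<Rightarrow> (real^'d \<Rightarrow> real^'d) \<Rightarrow> real^'d \<Rightarrow> real^'d^'d" where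
  "strain \<Omega> v x = (1/2) *\<^sub>R (wjac \<Omega> v x + transpose (wjac \<Omega> v x))"

definition wdiv :: "(real^'d) set \<Rightarrow> (real^'d \<Rightarrow> real^'d) \<Rightarrow> real^'d \<Rightarrow> real" where
  "wdiv \<Omega> v x = trace (wjac \<Omega> v x)"

text \<open>The inner product of \<^typ>\<open>real^'d^'d\<close> is the Frobenius product.\<close>

definition h1_inner :: "(real^'d) set \<Rightarrow> (real^'d \<Rightarrow> real^'d) \<Rightarrow> (real^'d \<Rightarrow> real^'d) \<Rightarrow> real" where
  "h1_inner \<Omega> u v = l2_inner \<Omega> u v + l2_inner \<Omega> (wjac \<Omega> u) (wjac \<Omega> v)"

definition h1_norm :: "(real^'d) set \<Rightarrow> (real^'d \<Rightarrow> real^'d) \<Rightarrow> real" where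
  "h1_norm \<Omega> v = sqrt (h1_inner \<Omega> v v)"

section \<open>Bilinear forms\<close>

definition form_a1 :: "(real^'d) set \<Rightarrow> real \<Rightarrow> (real^'d \<Rightarrow> real^'d) \<Rightarrow> (real^'d \<Rightarrow> real^'d) \<Rightarrow> real" where
  "form_a1 \<Omega> \<mu> u v = 2 * \<mu> * l2_inner \<Omega> (strain \<Omega> u) (strain \<Omega> v)"

definition form_b :: "(real^'d) set \<Rightarrow> (real^'d \<Rightarrow> real^'d) \<Rightarrow> (real^'d \<Rightarrow> real) \<Rightarrow> real" where
  "form_b \<Omega> v w = l2_inner \<Omega> w (wdiv \<Omega> v)"

definition form_a2 :: "(real^'d) set \<Rightarrow> real \<Rightarrow> (real^'d \<Rightarrow> real) \<Rightarrow> (real^'d \<Rightarrow> real) \<Rightarrow> real" where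
  "form_a2 \<Omega> lam \<xi> w = 1 / lam * l2_inner \<Omega> \<xi> w"

definition form_c :: "(real^'d) set \<Rightarrow> real \<Rightarrow> real \<Rightarrow> (real^'d \<Rightarrow> real) \<Rightarrow> (real^'d \<Rightarrow> real) \<Rightarrow> real" where
  "form_c \<Omega> lam \<alpha> p w = \<alpha> / lam * l2_inner \<Omega> p w"

definition form_a3 ::
  "(real^'d) set \<Rightarrow> real \<Rightarrow> real \<Rightarrow> real \<Rightarrow> (real^'d \<Rightarrow> real) \<Rightarrow> (real^'d \<Rightarrow> real) \<Rightarrow> real" where
  "form_a3 \<Omega> lam \<alpha> c0 p q = (c0 + \<alpha>\<^sup>2 / lam) * l2_inner \<Omega> p q"

definition form_d :: "(real^'d) set \<Rightarrow> real \<Rightarrow> (real^'d \<Rightarrow> real) \<Rightarrow> (real^'d \<Rightarrow> real) \<Rightarrow> real" where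
  "form_d \<Omega> kp p q = kp * l2_inner \<Omega> (wgrad \<Omega> p) (wgrad \<Omega> q)"

section \<open>Finite element spaces\<close>

definition poly_on :: "nat \<Rightarrow> (real^'d) set \<Rightarrow> (real^'d \<Rightarrow> real) \<Rightarrow> bool" where
  "poly_on k E u \<longleftrightarrow>
     (\<exists>a. \<forall>x\<in>E. u x = (\<Sum>m\<in>{m :: 'd \<Rightarrow> nat. sum m UNIV \<le> k}. a m * (\<Prod>j\<in>UNIV. (x $ j) ^ m j)))"

definition Vh :: "(real^'d) set \<Rightarrow> (real^'d) set \<Rightarrow> (real^'d) set set \<Rightarrow> nat \<Rightarrow> (real^'d \<Rightarrow> real^'d) set" where
  "Vh \<Omega> \<Gamma>u \<T> k =
     {v \<in> H1v \<Omega>. continuous_on (closure \<Omega>) v \<and> (\<forall>x\<in>\<Gamma>u. v x = 0) \<and>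
                  (\<forall>E\<in>\<T>. \<forall>i. poly_on k E (\<lambda>x. v x $ i))}"

definition Wh :: "(real^'d) set \<Rightarrow> (real^'d) set set \<Rightarrow> nat \<Rightarrow> (real^'d \<Rightarrow> real) set" where
  "Wh \<Omega> \<T> k =
     {w \<in> L2 \<Omega>. continuous_on (closure \<Omega>) w \<and> (\<forall>E\<in>\<T>. poly_on (k - 1) E w)}"

definition Mh :: "(real^'d) set \<Rightarrow> (real^'d) set \<Rightarrow> (real^'d) set set \<Rightarrow> nat \<Rightarrow> (real^'d \<Rightarrow> real) set" where
  "Mh \<Omega> \<Gamma>p \<T> l =
     {q \<in> H1 \<Omega>. continuous_on (closure \<Omega>) q \<and> (\<forall>x\<in>\<Gamma>p. q x = 0) \<and> (\<forall>E\<in>\<T>. poly_on l E q)}"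

text \<open>The supremum is taken in \<^typ>\<open>ereal\<close>, where it always exists.\<close>

definition inf_sup_condition ::
  "(real^'d) set \<Rightarrow> (real^'d \<Rightarrow> real^'d) set \<Rightarrow> (real^'d \<Rightarrow> real) set \<Rightarrow> real \<Rightarrow> bool" where
  "inf_sup_condition \<Omega> V W \<beta> \<longleftrightarrow>
     (\<forall>w\<in>W. (SUP v\<in>{v\<in>V. \<exists>x\<in>\<Omega>. v x \<noteq> 0}. ereal (form_b \<Omega> v w / h1_norm \<Omega> v)) \<ge> ereal (\<beta> * l2_norm \<Omega> w))"

section \<open>Monolithic BDF-2 scheme\<close>

definition bdf2 :: "real \<Rightarrow> (nat \<Rightarrow> 'a \<Rightarrow> real) \<Rightarrow> nat \<Rightarrow> 'a \<Rightarrow> real" where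
  "bdf2 \<Delta>t y n x = 1 / \<Delta>t * (3/2 * y n x - 2 * y (n - 1) x + 1/2 * y (n - 2) x)"

definition monolithic_bdf2 ::
  "(real^'d) set \<Rightarrow> real \<Rightarrow> real \<Rightarrow> real \<Rightarrow> real \<Rightarrow> real \<Rightarrow>
   (real^'d \<Rightarrow> real^'d) set \<Rightarrow> (real^'d \<Rightarrow> real) set \<Rightarrow> (real^'d \<Rightarrow> real) set \<Rightarrow>
   (real \<Rightarrow> real^'d \<Rightarrow> real^'d) \<Rightarrow> (real \<Rightarrow> real^'d \<Rightarrow> real) \<Rightarrow> real \<Rightarrow> nat \<Rightarrow>
   (nat \<Rightarrow> real^'d \<Rightarrow> real^'d) \<Rightarrow> (nat \<Rightarrow> real^'d \<Rightarrow> real) \<Rightarrow> (nat \<Rightarrow> real^'d \<Rightarrow> real) \<Rightarrow> bool" where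
  "monolithic_bdf2 \<Omega> lam \<mu> \<alpha> c0 kp V W M f g \<Delta>t N u \<xi> p \<longleftrightarrow>
     \<xi> 0 \<in> W \<and> \<xi> 1 \<in> W \<and> p 0 \<in> M \<and> p 1 \<in> M \<and>
     (\<forall>n\<in>{2..N}.
        u n \<in> V \<and> \<xi> n \<in> W \<and> p n \<in> M \<and>
        (\<forall>v\<in>V. form_a1 \<Omega> \<mu> (u n) v - form_b \<Omega> v (\<xi> n) = l2_inner \<Omega> (f (real n * \<Delta>t)) v) \<and>
        (\<forall>w\<in>W. form_b \<Omega> (u n) w + form_a2 \<Omega> lam (\<xi> n) w - form_c \<Omega> lam \<alpha> (p n) w = 0) \<and>
        (\<forall>q\<in>M. form_a3 \<Omega> lam \<alpha> c0 (bdf2 \<Delta>t p n) q - form_c \<Omega> lam \<alpha> q (bdf2 \<Delta>t \<xi> n)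
                 + form_d \<Omega> kp (p n) q = l2_inner \<Omega> (g (real n * \<Delta>t)) q))"

section \<open>Proper orthogonal decomposition\<close>

text \<open>Indices run over \<open>{..<L}\<close>, i.e. they are shifted by one against the usual \<open>1, \<dots>, L\<close>;
  \<open>v n\<close> is the \<open>n\<close>-th eigenvector of the correlation matrix.\<close>

definition sym_pos_def :: "nat \<Rightarrow> (nat \<Rightarrow> nat \<Rightarrow> real) \<Rightarrow> bool" where
  "sym_pos_def L A \<longleftrightarrow>
     (\<forall>i<L. \<forall>j<L. A i j = A j i) \<and>
     (\<forall>x. (\<exists>i<L. x i \<noteq> 0) \<longrightarrow> 0 < (\<Sum>i<L. \<Sum>j<L. x i * A i j * x j))"

definition ordered_eigensystem ::
  "nat \<Rightarrow> (nat \<Rightarrow> nat \<Rightarrow> real) \<Rightarrow> (nat \<Rightarrow> real) \<Rightarrow> (nat \<Rightarrow> nat \<Rightarrow> real) \<Rightarrow> bool" where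
  "ordered_eigensystem L A \<gamma> v \<longleftrightarrow>
     (\<forall>n<L. \<forall>i<L. (\<Sum>j<L. A i j * v n j) = \<gamma> n * v n i) \<and>
     (\<forall>m<L. \<forall>n<L. (\<Sum>i<L. v m i * v n i) = (if m = n then 1 else 0)) \<and>
     (\<forall>n<L. 0 < \<gamma> n) \<and> (\<forall>m n. m \<le> n \<and> n < L \<longrightarrow> \<gamma> n \<le> \<gamma> m)"

definition pod_mode ::
  "nat \<Rightarrow> (nat \<Rightarrow> 'a \<Rightarrow> 'b::real_vector) \<Rightarrow> (nat \<Rightarrow> real) \<Rightarrow> (nat \<Rightarrow> nat \<Rightarrow> real) \<Rightarrow> nat \<Rightarrow> 'a \<Rightarrow> 'b" where
  "pod_mode L \<phi> \<gamma> v n x = (\<gamma> n powr (-1/2)) *\<^sub>R (\<Sum>i<L. v n i *\<^sub>R \<phi> i x)"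

text \<open>A relation, since eigenvectors (and, for a repeated eigenvalue, the span of the leading
  modes) are not unique.\<close>

definition is_pod_space ::
  "(('a \<Rightarrow> 'b) \<Rightarrow> ('a \<Rightarrow> 'b) \<Rightarrow> real) \<Rightarrow> nat \<Rightarrow> (nat \<Rightarrow> 'a \<Rightarrow> 'b::real_vector) \<Rightarrow> nat \<Rightarrow> ('a \<Rightarrow> 'b) set \<Rightarrow> bool"
  where
  "is_pod_space ip L \<phi> Nr S \<longleftrightarrow>
     sym_pos_def L (\<lambda>i j. ip (\<phi> i) (\<phi> j)) \<and>
     (\<exists>\<gamma> v. ordered_eigensystem L (\<lambda>i j. ip (\<phi> i) (\<phi> j)) \<gamma> v \<and>
            S = {\<lambda>x. \<Sum>n<Nr. a n *\<^sub>R pod_mode L \<phi> \<gamma> v n x | a. True})"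

section \<open>ROM-based global-in-time iterative decoupled algorithm\<close>

definition mixed_solution ::
  "(real^'d) set \<Rightarrow> real \<Rightarrow> real \<Rightarrow> real \<Rightarrow> (real^'d \<Rightarrow> real^'d) set \<Rightarrow> (real^'d \<Rightarrow> real) set \<Rightarrow>
   (real^'d \<Rightarrow> real^'d) \<Rightarrow> (real^'d \<Rightarrow> real) \<Rightarrow> (real^'d \<Rightarrow> real^'d) \<Rightarrow> (real^'d \<Rightarrow> real) \<Rightarrow> bool" where
  "mixed_solution \<Omega> lam \<mu> \<alpha> V W F p u \<xi> \<longleftrightarrow>
     u \<in> V \<and> \<xi> \<in> W \<and>
     (\<forall>v\<in>V. form_a1 \<Omega> \<mu> u v - form_b \<Omega> v \<xi> = l2_inner \<Omega> F v) \<and>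
     (\<forall>w\<in>W. form_b \<Omega> u w + form_a2 \<Omega> lam \<xi> w = form_c \<Omega> lam \<alpha> p w)"

text \<open>\<open>p n i\<close>, \<open>\<xi> n i\<close>, \<open>u n i\<close> are the iterates at time level \<open>n\<close> and iteration \<open>i\<close>, and
  \<open>ut\<close>, \<open>\<xi>t\<close> the full-order solutions defined from \<open>p n i\<close>; \<open>\<xi>h\<close>, \<open>ph\<close> provide the data at
  \<open>n = 0, 1\<close>. The list \<open>ns\<close> is the index set of the snapshots.\<close>

definition rom_algorithm ::
  "(real^'d) set \<Rightarrow> real \<Rightarrow> real \<Rightarrow> real \<Rightarrow> real \<Rightarrow> real \<Rightarrow>
   (real^'d \<Rightarrow> real^'d) set \<Rightarrow> (real^'d \<Rightarrow> real) set \<Rightarrow> (real^'d \<Rightarrow> real) set \<Rightarrow>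
   (real \<Rightarrow> real^'d \<Rightarrow> real^'d) \<Rightarrow> (real \<Rightarrow> real^'d \<Rightarrow> real) \<Rightarrow> real \<Rightarrow> nat \<Rightarrow> nat list \<Rightarrow> nat \<Rightarrow>
   (nat \<Rightarrow> real^'d \<Rightarrow> real) \<Rightarrow> (nat \<Rightarrow> real^'d \<Rightarrow> real) \<Rightarrow>
   (nat \<Rightarrow> nat \<Rightarrow> real^'d \<Rightarrow> real) \<Rightarrow>
   (nat \<Rightarrow> nat \<Rightarrow> real^'d \<Rightarrow> real^'d) \<Rightarrow> (nat \<Rightarrow> nat \<Rightarrow> real^'d \<Rightarrow> real) \<Rightarrow>
   (nat \<Rightarrow> nat \<Rightarrow> real^'d \<Rightarrow> real^'d) \<Rightarrow> (nat \<Rightarrow> nat \<Rightarrow> real^'d \<Rightarrow> real) \<Rightarrow> bool" where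
  "rom_algorithm \<Omega> lam \<mu> \<alpha> c0 kp V W M f g \<Delta>t N ns Nr \<xi>h ph p ut \<xi>t u \<xi> \<longleftrightarrow>
     (\<forall>n\<in>{2..N}. \<xi> n 0 \<in> W) \<and>
     (\<forall>n<2. \<forall>i. \<xi> n i = \<xi>h n) \<and>
     (\<forall>i\<ge>1.
        (\<forall>n<2. p n i = ph n \<and> \<xi>t n i = \<xi>h n) \<and>
        (\<forall>n\<in>{2..N}.
           p n i \<in> M \<and>
           (\<forall>q\<in>M. form_a3 \<Omega> lam \<alpha> c0 (bdf2 \<Delta>t (\<lambda>m. p m i) n) q + form_d \<Omega> kp (p n i) q =
                   l2_inner \<Omega> (g (real n * \<Delta>t)) q
                   + form_c \<Omega> lam \<alpha> q (bdf2 \<Delta>t (\<lambda>m. \<xi> m (i - 1)) n))) \<and>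
        (\<forall>n\<in>{2..N}. mixed_solution \<Omega> lam \<mu> \<alpha> V W (f (real n * \<Delta>t)) (p n i) (ut n i) (\<xi>t n i)) \<and>
        (\<exists>Vr Wr.
           is_pod_space (h1_inner \<Omega>) (length ns) (\<lambda>\<beta>. ut (ns ! \<beta>) i) Nr Vr \<and>
           is_pod_space (l2_inner \<Omega>) (length ns) (\<lambda>\<beta>. \<xi>t (ns ! \<beta>) i) Nr Wr \<and>
           (\<forall>n\<in>{2..N}. mixed_solution \<Omega> lam \<mu> \<alpha> Vr Wr (f (real n * \<Delta>t)) (p n i) (u n i) (\<xi> n i))))"

text \<open>The error of the total pressure iterates, zero at the two initial time levels.\<close>

definition xi_error ::
  "(nat \<Rightarrow> nat \<Rightarrow> 'a \<Rightarrow> real) \<Rightarrow> (nat \<Rightarrow> 'a \<Rightarrow> real) \<Rightarrow> nat \<Rightarrow> nat \<Rightarrow> 'a \<Rightarrow> real" where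
  "xi_error \<xi> \<xi>h n i x = (if n < 2 then 0 else \<xi> n i x - \<xi>h n x)"

definition xi_error_sum ::
  "(real^'d) set \<Rightarrow> real \<Rightarrow> nat \<Rightarrow> (nat \<Rightarrow> nat \<Rightarrow> real^'d \<Rightarrow> real) \<Rightarrow> (nat \<Rightarrow> real^'d \<Rightarrow> real) \<Rightarrow> nat \<Rightarrow> real" where
  "xi_error_sum \<Omega> \<Delta>t N \<xi> \<xi>h i =
     (\<Sum>n=2..N. (l2_norm \<Omega> (bdf2 \<Delta>t (\<lambda>m. xi_error \<xi> \<xi>h m i) n))\<^sup>2)"

definition eps_ROM ::
  "(real^'d) set \<Rightarrow> nat \<Rightarrow> (nat \<Rightarrow> nat \<Rightarrow> real^'d \<Rightarrow> real) \<Rightarrow> (nat \<Rightarrow> nat \<Rightarrow> real^'d \<Rightarrow> real) \<Rightarrow> nat \<Rightarrow> real" where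
  "eps_ROM \<Omega> N \<xi> \<xi>t i = (MAX n\<in>{2..N}. (l2_norm \<Omega> (\<lambda>x. \<xi> n i x - \<xi>t n i x))\<^sup>2)"

end

theory Submission
  imports Defs
begin

text \<open>
  One sweep of the iteration, carried out with full-order solves, contracts the total pressure error
  by the factor \<open>K\<close>; the projection onto the POD spaces perturbs this contraction by an amount
  controlled by the reduced order modelling error.

  The contraction comes from two estimates for the differences to the monolithic solution. In the
  flow equation the error \<open>e\<^sub>p\<close> is tested with its own BDF-2 quotient \<open>D e\<^sub>p\<close>. The diffusion
  term \<open>d(e\<^sub>p, D e\<^sub>p)\<close>, summed over the time steps, is nonnegative by the telescoping identity behind
  the G-stability of BDF-2 (\<open>bdf2_sum_nonneg\<close>), and what remains is
  \<open>\<Sum> \<parallel>D e\<^sub>p\<parallel>\<^sup>2 \<le> (\<alpha> (c0 \<lambda> / \<alpha>\<^sup>2 + 1))^(-2) \<Sum> \<parallel>D e\<^sub>\<xi>\<parallel>\<^sup>2\<close> (\<open>pressure_error_bound\<close>).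
  The elasticity problem is linear, so the quotients \<open>D\<close> of its errors solve it with zero load. Testing with
  the solution and bounding the elastic energy from below through the inf-sup condition shows
  \<open>\<parallel>D e\<^sub>\<xi>\<parallel> \<le> \<alpha> / (C \<lambda> + 1) \<parallel>D e\<^sub>p\<parallel>\<close> with \<open>C = \<beta>\<^sup>2 / (2 \<mu>)\<close> (\<open>mixed_solution_stable\<close>). The product of
  the two factors is \<open>K\<close> (\<open>full_order_contraction\<close>).

  Writing the reduced iterate as the full-order one plus its projection error, and splitting the square
  of the sum by Young's inequality with the weight that turns \<open>K\<^sup>2\<close> into \<open>(1 + K\<^sup>2) / 2 < 1\<close>, gives
  the recursion (\<open>rom_error_recursion\<close>). Iterating it is a geometric series
  (\<open>perturbed_contraction_limsup\<close>).

  All of this uses that the forms are bilinear. The forms are built from a chosen representative of the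
  weak gradient, so bilinearity rests on the uniqueness of weak gradients almost everywhere, that is, on
  the fundamental lemma of the calculus of variations. It is proved here from smooth bump functions
  that approximate the indicator of a box, followed by differentiation of integrals over boxes.
\<close>

section \<open>Smooth bump functions and the fundamental lemma of the calculus of variations\<close>

text \<open>The powers of \<open>1/t\<close> make the family closed under differentiation up to linear combinations, and
  so every member is smooth, also across \<open>t = 0\<close>.\<close>

definition flat :: "nat \<Rightarrow> real \<Rightarrow> real" where
  "flat m t = (if 0 < t then inverse t ^ m * exp (- inverse t) else 0)"

lemma flat_tendsto_0: "((\<lambda>h. flat m h) \<longlongrightarrow> 0) (at 0)"
proof -
  have "((\<lambda>y::real. y ^ m / exp y) \<longlongrightarrow> 0) at_top"
    by (rule tendsto_power_div_exp_0)
  then have "((\<lambda>h::real. inverse h ^ m / exp (inverse h)) \<longlongrightarrow> 0) (at_right 0)"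
    by (rule filterlim_compose[OF _ filterlim_inverse_at_top_right])
  then have r: "(flat m \<longlongrightarrow> 0) (at_right 0)"
    by (rule Lim_transform_eventually)
       (auto simp: flat_def eventually_at_filter exp_minus field_simps)
  have l: "(flat m \<longlongrightarrow> 0) (at_left 0)"
    by (rule Lim_transform_eventually[of "\<lambda>_. 0"])
       (auto simp: flat_def eventually_at_filter)
  show ?thesis
    using l r by (simp add: filterlim_split_at)
qed

lemma flat_has_derivative:
  "(flat m has_real_derivative flat (m + 2) t - m * flat (m + 1) t) (at t)"
proof -
  consider "0 < t" | "t < 0" | "t = 0" by linarith
  then show ?thesis
  proof cases
    case 1
    have ev: "\<forall>\<^sub>F s in nhds t. inverse s ^ m * exp (- inverse s) = flat m s"
      using eventually_nhds_in_open[of "{0<..}" t] 1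
      by (auto elim!: eventually_mono simp: flat_def)
    have pow: "((\<lambda>s. inverse s ^ m) has_real_derivative - (m * inverse t ^ (m + 1))) (at t)"
      by (rule DERIV_power[OF DERIV_inverse, THEN DERIV_cong])
         (use 1 in \<open>cases m; auto simp: power2_eq_square power_Suc\<close>)+
    have exp': "((\<lambda>s. exp (- inverse s)) has_real_derivative exp (- inverse t) * inverse t ^ 2) (at t)"
      by (rule DERIV_chain2[OF DERIV_exp DERIV_minus[OF DERIV_inverse], THEN DERIV_cong])
         (use 1 in \<open>auto simp: numeral_2_eq_2\<close>)
    have "- (m * inverse t ^ (m + 1)) * exp (- inverse t) + exp (- inverse t) * inverse t ^ 2 * inverse t ^ m
        = inverse t ^ (m + 2) * exp (- inverse t) - m * (inverse t ^ (m + 1) * exp (- inverse t))"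
      by (simp only: power_add numeral_2_eq_2 power_Suc power_0) (simp add: algebra_simps)
    then have "((\<lambda>s. inverse s ^ m * exp (- inverse s)) has_real_derivative
             flat (m + 2) t - m * flat (m + 1) t) (at t)"
      using DERIV_mult[OF pow exp'] 1 by (simp only: flat_def if_True)
    then show ?thesis
      by (rule DERIV_cong_ev[OF refl ev refl, THEN iffD1])
  next
    case 2
    have ev: "\<forall>\<^sub>F s in nhds t. 0 = flat m s"
      using eventually_nhds_in_open[of "{..<0}" t] 2
      by (auto elim!: eventually_mono simp: flat_def)
    have "((\<lambda>s. 0) has_real_derivative flat (m + 2) t - m * flat (m + 1) t) (at t)"
      using 2 by (auto simp: flat_def)
    then show ?thesis
      by (rule DERIV_cong_ev[OF refl ev refl, THEN iffD1])
  next
    case 3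
    have "(\<lambda>h. (flat m (0 + h) - flat m 0) / h) \<midarrow>0\<rightarrow> 0"
      by (rule Lim_transform_eventually[OF flat_tendsto_0[of "Suc m"]])
         (auto simp: flat_def eventually_at_filter field_simps)
    then show ?thesis
      using 3 by (simp add: DERIV_def flat_def)
  qed
qed

text \<open>A class large enough to contain bumps and closed under partial derivatives, so that
  differentiability of its members already gives smoothness of every order.\<close>

inductive_set smooth_gen :: "(real^'d \<Rightarrow> real) set" where
  const: "(\<lambda>x. c) \<in> smooth_gen"
| flat: "(\<lambda>x. flat m (c * x $ i + e)) \<in> smooth_gen"
| add: "\<phi> \<in> smooth_gen \<Longrightarrow> \<psi> \<in> smooth_gen \<Longrightarrow> (\<lambda>x. \<phi> x + \<psi> x) \<in> smooth_gen"
| mult: "\<phi> \<in> smooth_gen \<Longrightarrow> \<psi> \<in> smooth_gen \<Longrightarrow> (\<lambda>x. \<phi> x * \<psi> x) \<in> smooth_gen"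

lemma partial_deriv_eqI:
  assumes "(\<phi> has_derivative D) (at x)" shows "partial_deriv j \<phi> x = D (axis j 1)"
  unfolding partial_deriv_def using frechet_derivative_at[OF assms] by simp

lemma has_derivative_flat_coord:
  "((\<lambda>x::real^'d. flat m (c * x $ i + e)) has_derivative
     (\<lambda>h. c * h $ i * (flat (m + 2) (c * x $ i + e) - m * flat (m + 1) (c * x $ i + e)))) (at x)"
  by (rule has_derivative_compose[OF _ flat_has_derivative[THEN has_field_derivative_imp_has_derivative],
        THEN has_derivative_eq_rhs])
     (auto intro!: derivative_eq_intros bounded_linear_imp_has_derivative bounded_linear_vec_nth)

lemma smooth_gen_differentiable:
  assumes "\<phi> \<in> smooth_gen" shows "\<phi> differentiable (at x)"
  using assms
proof induction
  case (flat m c i e)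
  show ?case using has_derivative_flat_coord differentiableI by blast
qed auto

lemma smooth_gen_partial_deriv:
  fixes \<phi> :: "real^'d \<Rightarrow> real"
  assumes "\<phi> \<in> smooth_gen" shows "partial_deriv j \<phi> \<in> smooth_gen"
  using assms
proof induction
  case (const c)
  have "partial_deriv j (\<lambda>x::real^'d. c) = (\<lambda>x. 0)"
    by (intro ext) (auto intro!: partial_deriv_eqI[THEN trans] derivative_eq_intros)
  then show ?case by (simp add: smooth_gen.const)
next
  case (flat m c i e)
  have "partial_deriv j (\<lambda>x. flat m (c * x $ i + e)) =
      (\<lambda>x. c * axis j 1 $ i * (flat (m + 2) (c * x $ i + e) + (- real m) * flat (m + 1) (c * x $ i + e)))"
    by (intro ext partial_deriv_eqI[OF has_derivative_flat_coord, THEN trans]) simp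
  then show ?case
    by (simp only:) (intro smooth_gen.intros)
next
  case (add \<phi> \<psi>)
  have "partial_deriv j (\<lambda>x. \<phi> x + \<psi> x) = (\<lambda>x. partial_deriv j \<phi> x + partial_deriv j \<psi> x)"
    unfolding partial_deriv_def[of j \<phi>] partial_deriv_def[of j \<psi>]
    using add.hyps[THEN smooth_gen_differentiable]
    by (intro ext partial_deriv_eqI[THEN trans]) 
       (auto intro!: derivative_eq_intros simp: frechet_derivative_works)
  then show ?case using add.IH by (auto intro!: smooth_gen.intros)
next
  case (mult \<phi> \<psi>)
  have "partial_deriv j (\<lambda>x. \<phi> x * \<psi> x) =
      (\<lambda>x. \<phi> x * partial_deriv j \<psi> x + partial_deriv j \<phi> x * \<psi> x)"
    unfolding partial_deriv_def[of j \<phi>] partial_deriv_def[of j \<psi>]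
    using mult.hyps[THEN smooth_gen_differentiable]
    by (intro ext partial_deriv_eqI[OF has_derivative_mult, THEN trans])
       (auto simp: frechet_derivative_works)
  then show ?case using mult.IH mult.hyps by (auto intro!: smooth_gen.intros)
qed

lemma smooth_gen_Ck: "\<phi> \<in> smooth_gen \<Longrightarrow> Ck m \<phi>"
proof (induction m arbitrary: \<phi>)
  case 0
  then show ?case
    using smooth_gen_differentiable
    by (auto simp: continuous_on_eq_continuous_at intro: differentiable_imp_continuous_within)
next
  case (Suc m)
  then show ?case by (simp add: smooth_gen_differentiable smooth_gen_partial_deriv)
qed

lemma smooth_gen_prod:
  "finite J \<Longrightarrow> (\<And>j. j \<in> J \<Longrightarrow> \<phi> j \<in> smooth_gen) \<Longrightarrow> (\<lambda>x. \<Prod>j\<in>J. \<phi> j x) \<in> smooth_gen"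
  by (induction J rule: finite_induct) (auto intro: smooth_gen.const smooth_gen.mult)

text \<open>Since \<open>flat 0 (s * t) = exp (- 1 / (s * t))\<close> tends to \<open>1\<close> for \<open>t > 0\<close> and \<open>s \<rightarrow> \<infinity>\<close>, rescaling the
  argument alone turns a bump into a smooth approximation, bounded by \<open>1\<close>, of the indicator of the
  open box, and the support stays inside the closed box.\<close>

definition bump :: "real^'d \<Rightarrow> real^'d \<Rightarrow> nat \<Rightarrow> real^'d \<Rightarrow> real" where
  "bump a b n x = (\<Prod>j\<in>UNIV. flat 0 (Suc n * (x $ j - a $ j)) * flat 0 (Suc n * (b $ j - x $ j)))"

lemma flat_0_bounds: "0 \<le> flat 0 t" "flat 0 t \<le> 1"
  by (auto simp: flat_def)

lemma flat_0_tendsto: "(\<lambda>n. flat 0 (real (Suc n) * t)) \<longlonglongrightarrow> (if 0 < t then 1 else 0)"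
proof (cases "0 < t")
  case True
  have "(\<lambda>n. exp (- (inverse (real (Suc n)) * inverse t))) \<longlonglongrightarrow> exp (- (0 * inverse t))"
    by (intro tendsto_intros LIMSEQ_inverse_real_of_nat)
  then show ?thesis using True by (simp add: flat_def zero_less_mult_iff del: of_nat_Suc)
next
  case False
  then show ?thesis by (simp add: flat_def zero_less_mult_iff not_less del: of_nat_Suc)
qed

lemma bump_tendsto: "(\<lambda>n. bump a b n x) \<longlonglongrightarrow> indicator (box a b) x"
proof -
  have "(\<Prod>j\<in>UNIV. (if 0 < x $ j - a $ j then 1 else 0) * (if 0 < b $ j - x $ j then 1 else 0))
      = (\<Prod>j\<in>UNIV. if a $ j < x $ j \<and> x $ j < b $ j then 1 else (0::real))"
    by (intro prod.cong) auto
  also have "\<dots> = indicator (box a b) x"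
    by (auto simp: indicator_def mem_box_cart)
  finally have eq: "indicator (box a b) x = (\<Prod>j\<in>UNIV. (if 0 < x $ j - a $ j then 1 else 0)
      * (if 0 < b $ j - x $ j then 1 else (0::real)))" ..
  show ?thesis
    unfolding bump_def eq by (intro tendsto_prod tendsto_mult flat_0_tendsto)
qed

lemma bump_bounds: "\<bar>bump a b n x\<bar> \<le> 1"
  unfolding bump_def abs_prod
  by (intro prod_le_1) (auto simp: abs_mult flat_0_bounds intro!: mult_le_one)

lemma bump_eq_0: 
  assumes "x \<notin> cbox a b" shows "bump a b n x = 0"
proof -
  obtain j where "x $ j < a $ j \<or> b $ j < x $ j"
    using assms by (auto simp: mem_box_cart not_le)
  then have "flat 0 (Suc n * (x $ j - a $ j)) * flat 0 (Suc n * (b $ j - x $ j)) = 0"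
    by (auto simp: flat_def zero_less_mult_iff simp del: of_nat_Suc)
  then show ?thesis
    unfolding bump_def by (intro prod_zero) auto
qed

lemma bump_test_function:
  assumes "cbox a b \<subseteq> \<Omega>" shows "bump a b n \<in> test_functions \<Omega>"
proof -
  have "bump a b n = (\<lambda>x. \<Prod>j\<in>UNIV. flat 0 (Suc n * x $ j + - (Suc n * a $ j)) *
      flat 0 (- real (Suc n) * x $ j + real (Suc n) * b $ j))"
    by (auto simp: bump_def fun_eq_iff algebra_simps)
  also have "\<dots> \<in> smooth_gen"
    by (intro smooth_gen_prod smooth_gen.intros) auto
  finally have "Ck m (bump a b n)" for m by (rule smooth_gen_Ck)
  moreover have sub: "closure {x. bump a b n x \<noteq> 0} \<subseteq> cbox a b"
    by (intro closure_minimal) (use bump_eq_0 in auto)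
  moreover have "compact (closure {x. bump a b n x \<noteq> 0})"
    using sub by (meson bounded_cbox bounded_subset closed_closure compact_eq_bounded_closed)
  ultimately show ?thesis using assms by (auto simp: test_functions_def)
qed

text \<open>Bump functions and dominated convergence show that the integral over every closed box inside
  \<open>\<Omega>\<close> vanishes; almost every point is a limit of averages over shrinking boxes.\<close>

lemma ae_zero_if_orthogonal_to_test_functions:
  fixes \<Omega> :: "(real^'d) set" and h :: "real^'d \<Rightarrow> real"
  assumes \<Omega>: "open \<Omega>" and h: "integrable (lebesgue_on \<Omega>) h"
    and orth: "\<And>\<phi>. \<phi> \<in> test_functions \<Omega> \<Longrightarrow> (LINT x|lebesgue_on \<Omega>. h x * \<phi> x) = 0"
  shows "AE x in lebesgue_on \<Omega>. h x = 0"
proof -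
  have meas[simp]: "\<Omega> \<in> sets lebesgue" using \<Omega> by auto
  define f where "f = (\<lambda>x. if x \<in> \<Omega> then h x else 0)"
  have "integrable lebesgue (\<lambda>x. indicator \<Omega> x *\<^sub>R h x)"
    using h by (simp add: integrable_restrict_space)
  moreover have "(\<lambda>x. indicator \<Omega> x *\<^sub>R h x) = f"
    by (simp add: f_def indicator_def fun_eq_iff)
  ultimately have "f absolutely_integrable_on UNIV"
    by (simp add: set_integrable_def)
  then have f_ai: "f absolutely_integrable_on S" if "S \<in> sets lebesgue" for S
    using that set_integrable_subset by blast
  have box0: "integral (cbox a b) f = 0" if ab: "cbox a b \<subseteq> \<Omega>" for a b
  proof -
    have box_sub: "box a b \<subseteq> \<Omega>"
      using ab box_subset_cbox by blast
    have lim: "(\<lambda>n. LINT x|lebesgue_on \<Omega>. h x * bump a b n x) \<longlonglongrightarrow>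
        (LINT x|lebesgue_on \<Omega>. h x * indicator (box a b) x)"
    proof (rule integral_dominated_convergence[where w="\<lambda>x. norm (h x)"])
      have "bump a b n \<in> borel_measurable borel" for n
        using bump_test_function[OF ab, of n]
        by (intro borel_measurable_continuous_onI) (auto simp: test_functions_def dest: spec[of _ 0])
      then have "bump a b n \<in> borel_measurable (lebesgue_on \<Omega>)" for n
        by (simp add: measurable_completion measurable_restrict_space1)
      then show "(\<lambda>x. h x * bump a b n x) \<in> borel_measurable (lebesgue_on \<Omega>)" for n
        using h by auto
      show "(\<lambda>x. h x * indicator (box a b) x) \<in> borel_measurable (lebesgue_on \<Omega>)"
        using h box_sub
        by (intro borel_measurable_times borel_measurable_indicator) (auto simp: sets_restrict_space_iff)
      show "AE x in lebesgue_on \<Omega>. norm (h x * bump a b n x) \<le> norm (h x)" for n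
        using bump_bounds[of a b n] by (auto simp: abs_mult intro!: AE_I2 mult_right_le_one_le)
      show "AE x in lebesgue_on \<Omega>. (\<lambda>n. h x * bump a b n x) \<longlonglongrightarrow> h x * indicator (box a b) x"
        by (intro AE_I2 tendsto_intros bump_tendsto)
    qed (use h in auto)
    have "(LINT x|lebesgue_on \<Omega>. h x * bump a b n x) = 0" for n
      by (intro orth bump_test_function ab)
    with lim have "(LINT x|lebesgue_on \<Omega>. h x * indicator (box a b) x) = 0"
      by (simp add: LIMSEQ_const_iff)
    moreover have "indicator \<Omega> x *\<^sub>R (h x * indicator (box a b) x) = indicator (box a b) x *\<^sub>R f x" for x
      using box_sub by (auto simp: f_def indicator_def)
    then have "(LINT x|lebesgue_on \<Omega>. h x * indicator (box a b) x) = (LINT x:box a b|lebesgue. f x)"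
      by (subst integral_restrict_space) (simp, simp only: set_lebesgue_integral_def)
    moreover have "(LINT x:box a b|lebesgue. f x) = integral (box a b) f"
      by (intro set_lebesgue_integral_eq_integral f_ai) auto
    ultimately show ?thesis by (simp add: integral_open_interval)
  qed
  obtain N where N: "negligible N" and lim: "\<And>x e. \<lbrakk>x \<notin> N; 0 < e\<rbrakk> \<Longrightarrow>
      \<exists>d>0. \<forall>r. 0 < r \<and> r < d \<longrightarrow>
        norm (integral (cbox x (x + r *\<^sub>R One)) f /\<^sub>R r ^ DIM(real^'d) - f x) < e"
    using integrable_ccontinuous_explicit[of f] f_ai
    by (metis lmeasurable_cbox fmeasurableD set_lebesgue_integral_eq_integral(1))
  have "f x = 0" if x: "x \<in> \<Omega>" "x \<notin> N" for x
  proof (rule ccontr)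
    assume "f x \<noteq> 0"
    then obtain d where d: "d > 0" and dl: "\<And>r. 0 < r \<Longrightarrow> r < d \<Longrightarrow>
        norm (integral (cbox x (x + r *\<^sub>R One)) f /\<^sub>R r ^ DIM(real^'d) - f x) < norm (f x)"
      using lim[OF x(2), of "norm (f x)"] by auto
    obtain \<rho> where \<rho>: "\<rho> > 0" "ball x \<rho> \<subseteq> \<Omega>" using \<Omega> x(1) openE by blast
    define r where "r = min (d / 2) (\<rho> / (2 * norm (One :: real^'d)))"
    have pos: "0 < norm (One :: real^'d)" by (simp)
    have r: "0 < r" "r < d" "r * norm (One :: real^'d) < \<rho>"
      using d \<rho>(1) pos by (auto simp: r_def min_def field_simps)
    have "cbox x (x + r *\<^sub>R One) \<subseteq> ball x \<rho>"
    proof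
      fix y assume y: "y \<in> cbox x (x + r *\<^sub>R One)"
      have "norm (y - x) \<le> norm (r *\<^sub>R (One :: real^'d))"
        using y by (intro norm_le_componentwise) (auto simp: mem_box inner_simps abs_if)
      then show "y \<in> ball x \<rho>" using r by (simp add: dist_norm norm_minus_commute)
    qed
    then have "integral (cbox x (x + r *\<^sub>R One)) f = 0" using \<rho> box0 by blast
    then show False using dl[OF r(1,2)] by simp
  qed
  then have "{x \<in> \<Omega>. h x \<noteq> 0} \<subseteq> N" by (auto simp: f_def)
  then have "negligible {x \<in> \<Omega>. h x \<noteq> 0}" using N negligible_subset by blast
  then have "AE x in lebesgue. x \<in> \<Omega> \<longrightarrow> h x = 0"
    by (intro AE_I'[of "{x \<in> \<Omega>. h x \<noteq> 0}"]) (auto simp: negligible_iff_null_sets)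
  then show ?thesis by (simp add: AE_restrict_space_iff)
qed

section \<open>Positive semidefinite forms on spaces of functions\<close>

text \<open>Functions of type \<^typ>\<open>'a \<Rightarrow> 'b\<close> do not form a vector space in the type class sense, hence closure
  under linear combinations is an assumption here. The form is the square of a seminorm; elasticity
  and diffusion energies and the \<open>L\<^sup>2\<close> inner product are all of this kind.\<close>

locale psd_form =
  fixes V :: "('a \<Rightarrow> 'b::real_vector) set" and B :: "('a \<Rightarrow> 'b) \<Rightarrow> ('a \<Rightarrow> 'b) \<Rightarrow> real"
  assumes comb: "\<And>u v a b. u \<in> V \<Longrightarrow> v \<in> V \<Longrightarrow> (\<lambda>x. a *\<^sub>R u x + b *\<^sub>R v x) \<in> V"
    and lin: "\<And>u v w a b. u \<in> V \<Longrightarrow> v \<in> V \<Longrightarrow> w \<in> V \<Longrightarrow>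
        B (\<lambda>x. a *\<^sub>R u x + b *\<^sub>R v x) w = a * B u w + b * B v w"
    and sym: "\<And>u v. u \<in> V \<Longrightarrow> v \<in> V \<Longrightarrow> B u v = B v u"
    and nonneg: "\<And>u. u \<in> V \<Longrightarrow> 0 \<le> B u u"
begin

lemma lin_right:
  "u \<in> V \<Longrightarrow> v \<in> V \<Longrightarrow> w \<in> V \<Longrightarrow> B w (\<lambda>x. a *\<^sub>R u x + b *\<^sub>R v x) = a * B w u + b * B w v"
  using lin[of u v w a b] sym[OF comb[of u v a b], of w] sym[of u w] sym[of v w] by simp

lemma quadratic:
  assumes "u \<in> V" "v \<in> V"
  shows "B (\<lambda>x. a *\<^sub>R u x + b *\<^sub>R v x) (\<lambda>x. a *\<^sub>R u x + b *\<^sub>R v x)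
    = a\<^sup>2 * B u u + 2 * a * b * B u v + b\<^sup>2 * B v v"
  using assms by (simp add: comb lin lin_right sym[of v u] power2_eq_square algebra_simps)

lemma cauchy_schwarz:
  assumes u: "u \<in> V" and v: "v \<in> V"
  shows "(B u v)\<^sup>2 \<le> B u u * B v v"
proof (cases "B v v = 0")
  case True
  have "B u v = 0"
  proof (rule ccontr)
    assume nz: "B u v \<noteq> 0"
    \<comment> \<open>For \<open>B v v = 0\<close> the form is affine along \<open>u + s v\<close>; at this \<open>s\<close> it takes the value \<open>- 1\<close>.\<close>
    have "0 \<le> 1\<^sup>2 * B u u + 2 * 1 * (- (B u u + 1) / (2 * B u v)) * B u v
        + (- (B u u + 1) / (2 * B u v))\<^sup>2 * B v v"
      unfolding quadratic[OF u v, symmetric] by (intro nonneg comb u v)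
    then show False using nz True by (simp add: field_simps)
  qed
  then show ?thesis using True by simp
next
  case False
  then have pos: "0 < B v v" using nonneg[OF v] by simp
  \<comment> \<open>The value of the form at \<open>B v v \<cdot> u - B u v \<cdot> v\<close>, a multiple of the component of \<open>u\<close>
    orthogonal to \<open>v\<close>.\<close>
  have "0 \<le> (B v v)\<^sup>2 * B u u + 2 * B v v * (- B u v) * B u v + (- B u v)\<^sup>2 * B v v"
    unfolding quadratic[OF u v, symmetric] by (intro nonneg comb u v)
  also have "\<dots> = B v v * (B u u * B v v - (B u v)\<^sup>2)"
    by (simp add: power2_eq_square algebra_simps)
  finally show ?thesis using pos by (simp add: zero_le_mult_iff)
qed

lemma cauchy_schwarz_sqrt:
  assumes "u \<in> V" "v \<in> V"
  shows "B u v \<le> sqrt (B u u) * sqrt (B v v)"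
  using real_le_rsqrt[OF cauchy_schwarz[OF assms]] by (simp add: real_sqrt_mult)

lemma young:
  assumes u: "u \<in> V" and v: "v \<in> V" and t: "0 < t"
  shows "2 * B u v \<le> t * B u u + B v v / t"
proof -
  have "0 \<le> t\<^sup>2 * B u u + 2 * t * (- 1) * B u v + (- 1)\<^sup>2 * B v v"
    unfolding quadratic[OF u v, symmetric] by (intro nonneg comb u v)
  then show ?thesis using t by (simp add: field_simps power2_eq_square)
qed

lemma norm_add_young:
  assumes u: "u \<in> V" and v: "v \<in> V" and t: "0 < t"
  shows "B (\<lambda>x. u x + v x) (\<lambda>x. u x + v x) \<le> (1 + t) * B u u + (1 + 1 / t) * B v v"
  using quadratic[OF u v, of 1 1] young[OF u v t] by (simp add: field_simps)

lemma zero: "u \<in> V \<Longrightarrow> B (\<lambda>x. 0) (\<lambda>x. 0) = 0"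
  using quadratic[of u u 0 0] by simp

lemma abs_le:
  assumes "u \<in> V" "v \<in> V" "B u u \<le> M" "B v v \<le> M"
  shows "\<bar>B u v\<bar> \<le> M"
  using young[OF assms(1,2), of 1] assms quadratic[OF assms(1,2), of 1 1]
    nonneg[OF comb[OF assms(1,2), of 1 1]]
  by simp

end

text \<open>Nested binary combinations, so that the closure and linearity rules for two summands apply
  directly.\<close>

lemma bdf2_eq_comb:
  "bdf2 dt e n = (\<lambda>x. 1 *\<^sub>R ((3/2/dt) *\<^sub>R e n x + (-2/dt) *\<^sub>R e (n - 1) x) + (1/2/dt) *\<^sub>R e (n - 2) x)"
  by (auto simp: bdf2_def fun_eq_iff algebra_simps)

text \<open>Differences appear as \<open>1 u + (-1) v\<close> because the closure and linearity rules have this shape.\<close>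

lemma bdf2_diff:
  "bdf2 dt (\<lambda>m x. 1 *\<^sub>R a m x + (-1) *\<^sub>R b m x) n = (\<lambda>x. 1 *\<^sub>R bdf2 dt a n x + (-1) *\<^sub>R bdf2 dt b n x)"
  by (simp add: bdf2_def fun_eq_iff diff_divide_distrib add_divide_distrib algebra_simps)

text \<open>The BDF-2 quotient acts on sequences of real-valued functions.\<close>

locale real_psd_form = psd_form V B for V :: "('a \<Rightarrow> real) set" and B
begin

lemma bdf2_closed:
  assumes "e n \<in> V" "e (n - 1) \<in> V" "e (n - 2) \<in> V" shows "bdf2 dt e n \<in> V"
  unfolding bdf2_eq_comb by (intro comb assms)

lemma bdf2_lin:
  assumes "e n \<in> V" "e (n - 1) \<in> V" "e (n - 2) \<in> V" "w \<in> V"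
  shows "B (bdf2 dt e n) w = (3/2 * B (e n) w - 2 * B (e (n - 1)) w + 1/2 * B (e (n - 2)) w) / dt"
  unfolding bdf2_eq_comb using assms by (simp only: lin comb) (simp add: add_divide_distrib diff_divide_distrib)

text \<open>The coefficients of the BDF-2 quotient have absolute sum \<open>3/2 + 2 + 1/2 = 4\<close>.\<close>

lemma bdf2_norm_bound:
  assumes e: "e n \<in> V" "e (n - 1) \<in> V" "e (n - 2) \<in> V"
    and M: "B (e n) (e n) \<le> M" "B (e (n - 1)) (e (n - 1)) \<le> M" "B (e (n - 2)) (e (n - 2)) \<le> M"
    and dt: "0 < dt"
  shows "B (bdf2 dt e n) (bdf2 dt e n) \<le> 16 * M / dt\<^sup>2"
proof -
  have bd: "B (bdf2 dt e n) z \<le> 4 * R / dt"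
    if "z \<in> V" "\<And>y. y \<in> {e n, e (n - 1), e (n - 2)} \<Longrightarrow> \<bar>B y z\<bar> \<le> R" for z R
  proof -
    have "3/2 * B (e n) z - 2 * B (e (n - 1)) z + 1/2 * B (e (n - 2)) z \<le> 4 * R"
      using that(2)[of "e n"] that(2)[of "e (n - 1)"] that(2)[of "e (n - 2)"] by auto
    then show ?thesis using dt that(1) e by (simp add: bdf2_lin divide_right_mono)
  qed
  have "\<bar>B y (bdf2 dt e n)\<bar> \<le> 4 * M / dt" if y: "y \<in> {e n, e (n - 1), e (n - 2)}" for y
  proof -
    have [simp]: "y \<in> V" using y e by auto
    have r: "\<bar>B z y\<bar> \<le> M" if "z \<in> {e n, e (n - 1), e (n - 2)}" for z
      using that y e M by (intro abs_le) auto
    have "\<bar>3/2 * B (e n) y - 2 * B (e (n - 1)) y + 1/2 * B (e (n - 2)) y\<bar> \<le> 4 * M"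
      using r[of "e n"] r[of "e (n - 1)"] r[of "e (n - 2)"] by auto
    then have "\<bar>B (bdf2 dt e n) y\<bar> \<le> 4 * M / dt"
      using dt e by (simp add: bdf2_lin abs_divide divide_right_mono)
    then show ?thesis using sym[OF bdf2_closed[OF e] \<open>y \<in> V\<close>] by simp
  qed
  from bd[OF bdf2_closed[OF e] this] show ?thesis
    by (simp add: power2_eq_square)
qed

text \<open>Up to a factor, \<open>B (e n) (D e n)\<close> is the increment of the energy
  \<open>\<parallel>e n\<parallel>\<^sup>2 + \<parallel>2 e n - e (n - 1)\<parallel>\<^sup>2\<close> plus the square of the second difference. The sum telescopes to the
  energy at the end, since the energy at the start vanishes.\<close>

lemma bdf2_sum_nonneg:
  assumes e: "\<And>n. n \<le> N \<Longrightarrow> e n \<in> V" and zero: "\<And>n. n < 2 \<Longrightarrow> e n = (\<lambda>x. 0)" and dt: "0 < dt"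
  shows "0 \<le> (\<Sum>n=2..N. B (e n) (bdf2 dt e n))"
proof -
  define E where "E n = B (e n) (e n)
      + B (\<lambda>x. 2 *\<^sub>R e n x + (-1) *\<^sub>R e (n - 1) x) (\<lambda>x. 2 *\<^sub>R e n x + (-1) *\<^sub>R e (n - 1) x)" for n
  have E_nonneg: "0 \<le> E n" if "n \<le> N" for n
    unfolding E_def using that by (intro add_nonneg_nonneg nonneg comb e) auto
  have E_step: "E n - E (n - 1) \<le> 4 * dt * B (e n) (bdf2 dt e n)" if n: "2 \<le> n" "n \<le> N" for n
  proof -
    let ?s = "\<lambda>x. 1 *\<^sub>R (1 *\<^sub>R e n x + (-2) *\<^sub>R e (n - 1) x) + 1 *\<^sub>R e (n - 2) x"
    have en: "e n \<in> V" "e (n - 1) \<in> V" "e (n - 2) \<in> V" using n by (auto intro: e)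
    have n1: "n - 1 - 1 = n - 2" by simp
    have "0 \<le> B ?s ?s"
      by (intro nonneg comb en)
    also have "B ?s ?s = 4 * dt * B (e n) (bdf2 dt e n) - (E n - E (n - 1))"
      using dt sym[OF en(2,1)] sym[OF en(3,1)] sym[OF en(3,2)] sym[OF bdf2_closed[OF en, of dt] en(1)]
      by (simp only: E_def n1 quadratic comb lin en bdf2_lin) (simp add: field_simps power2_eq_square)
    finally show ?thesis by simp
  qed
  have tele: "E m \<le> 4 * dt * (\<Sum>n=2..m. B (e n) (bdf2 dt e n))" if "1 \<le> m" "m \<le> N" for m
    using that
  proof (induction m rule: dec_induct)
    case base
    have "B (\<lambda>x. 0) (\<lambda>x. 0) = 0" using psd_form.zero[OF psd_form_axioms e[of 0]] by simp
    then show ?case by (simp add: E_def zero)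
  next
    case (step n)
    then show ?case using E_step[of "Suc n"] by (simp add: algebra_simps)
  qed
  show ?thesis
  proof (cases "1 \<le> N")
    case True
    then have "0 \<le> 4 * dt * (\<Sum>n=2..N. B (e n) (bdf2 dt e n))"
      using tele[of N] E_nonneg[of N] by linarith
    then show ?thesis using dt by (simp add: zero_le_mult_iff)
  qed simp
qed

end

section \<open>The space of square integrable functions\<close>

lemma L2_D:
  assumes "u \<in> L2 \<Omega>"
  shows "u \<in> borel_measurable (lebesgue_on \<Omega>)" "integrable (lebesgue_on \<Omega>) (\<lambda>x. (norm (u x))\<^sup>2)"
  using assms by (auto simp: L2_def)

lemma L2_integrable_inner:
  assumes u: "u \<in> L2 \<Omega>" and v: "v \<in> L2 \<Omega>"
  shows "integrable (lebesgue_on \<Omega>) (\<lambda>x. u x \<bullet> v x)"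
proof (rule Bochner_Integration.integrable_bound)
  show "integrable (lebesgue_on \<Omega>) (\<lambda>x. (norm (u x))\<^sup>2 + (norm (v x))\<^sup>2)"
    using L2_D(2)[OF u] L2_D(2)[OF v] by simp
  show "(\<lambda>x. u x \<bullet> v x) \<in> borel_measurable (lebesgue_on \<Omega>)"
    using L2_D(1)[OF u] L2_D(1)[OF v] by measurable
  have "\<bar>a \<bullet> b\<bar> \<le> (norm a)\<^sup>2 + (norm b)\<^sup>2" for a b :: 'b
  proof -
    have "2 * (norm a * norm b) \<le> (norm a)\<^sup>2 + (norm b)\<^sup>2"
      using sum_squares_bound[of "norm a" "norm b"] by (simp add: mult.assoc)
    moreover have "0 \<le> norm a * norm b" by simp
    ultimately show ?thesis using Cauchy_Schwarz_ineq2[of a b] by linarith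
  qed
  then show "AE x in lebesgue_on \<Omega>. norm (u x \<bullet> v x) \<le> norm ((norm (u x))\<^sup>2 + (norm (v x))\<^sup>2)"
    by (intro AE_I2) (simp add: abs_of_nonneg)
qed

lemma L2_bounded:
  assumes u: "u \<in> L2 \<Omega>" and w: "w \<in> borel_measurable (lebesgue_on \<Omega>)"
    and le: "\<And>x. norm (w x) \<le> norm (u x)"
  shows "w \<in> L2 \<Omega>"
  unfolding L2_def
proof (intro CollectI conjI w Bochner_Integration.integrable_bound[OF L2_D(2)[OF u]] AE_I2)
  show "(\<lambda>x. (norm (w x))\<^sup>2) \<in> borel_measurable (lebesgue_on \<Omega>)" using w by measurable
  show "norm ((norm (w x))\<^sup>2) \<le> norm ((norm (u x))\<^sup>2)" for x
    using le[of x] by (simp add: power_mono)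
qed

lemma L2_comb:
  assumes u: "u \<in> L2 \<Omega>" and v: "v \<in> L2 \<Omega>"
  shows "(\<lambda>x. a *\<^sub>R u x + b *\<^sub>R v x) \<in> L2 \<Omega>"
proof -
  have "integrable (lebesgue_on \<Omega>) (\<lambda>x. a\<^sup>2 * (u x \<bullet> u x) + 2 * a * b * (u x \<bullet> v x) + b\<^sup>2 * (v x \<bullet> v x))"
    by (intro Bochner_Integration.integrable_add integrable_mult_right L2_integrable_inner u v)
  moreover have "(norm (a *\<^sub>R u x + b *\<^sub>R v x))\<^sup>2
      = a\<^sup>2 * (u x \<bullet> u x) + 2 * a * b * (u x \<bullet> v x) + b\<^sup>2 * (v x \<bullet> v x)" for x
    unfolding power2_norm_eq_inner
    by (simp add: inner_simps inner_commute[of "v x" "u x"] power2_eq_square algebra_simps)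
  ultimately show ?thesis
    using L2_D(1)[OF u] L2_D(1)[OF v] by (simp add: L2_def)
qed

lemma l2_inner_psd: "psd_form (L2 \<Omega>) (l2_inner \<Omega>)"
proof
  show "l2_inner \<Omega> (\<lambda>x. a *\<^sub>R u x + b *\<^sub>R v x) w = a * l2_inner \<Omega> u w + b * l2_inner \<Omega> v w"
    if "u \<in> L2 \<Omega>" "v \<in> L2 \<Omega>" "w \<in> L2 \<Omega>" for u v w :: "'a \<Rightarrow> 'b" and a b
    using that by (simp add: l2_inner_def inner_simps L2_integrable_inner)
qed (auto simp: L2_comb l2_inner_def inner_commute intro!: integral_nonneg)

lemma l2_inner_real_psd: "real_psd_form (L2 \<Omega>) (l2_inner \<Omega>)"
  by (intro real_psd_form.intro l2_inner_psd)

lemma l2_norm_power2: "(l2_norm \<Omega> u)\<^sup>2 = l2_inner \<Omega> u u"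
  by (simp add: l2_norm_def l2_inner_def integral_nonneg)

lemma l2_norm_nonneg: "0 \<le> l2_norm \<Omega> u"
  by (simp add: l2_norm_def l2_inner_def integral_nonneg)

lemma l2_inner_commute: "l2_inner \<Omega> u v = l2_inner \<Omega> v u"
  by (simp add: l2_inner_def inner_commute)

lemma l2_inner_zero: "l2_inner \<Omega> (\<lambda>x. 0) v = 0"
  by (simp add: l2_inner_def)

lemma l2_inner_cong_AE:
  assumes "u \<in> L2 \<Omega>" "u' \<in> L2 \<Omega>" "v \<in> L2 \<Omega>" and ae: "AE x in lebesgue_on \<Omega>. u x = u' x"
  shows "l2_inner \<Omega> u v = l2_inner \<Omega> u' v"
  unfolding l2_inner_def
proof (rule integral_cong_AE)
  show "AE x in lebesgue_on \<Omega>. u x \<bullet> v x = u' x \<bullet> v x" using ae by eventually_elim simp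
qed (intro borel_measurable_integrable L2_integrable_inner assms)+

lemma L2_component:
  fixes F :: "'a::euclidean_space \<Rightarrow> 'b::euclidean_space ^ 'n"
  assumes "F \<in> L2 \<Omega>" shows "(\<lambda>x. F x $ i) \<in> L2 \<Omega>"
proof (rule L2_bounded[OF assms])
  have "continuous_on UNIV (\<lambda>v::'b^'n. v $ i)" by (intro continuous_intros)
  then show "(\<lambda>x. F x $ i) \<in> borel_measurable (lebesgue_on \<Omega>)"
    using L2_D(1)[OF assms] borel_measurable_continuous_on by blast
qed (rule Finite_Cartesian_Product.norm_nth_le)

lemma L2_vec:
  fixes F :: "'a::euclidean_space \<Rightarrow> 'b::euclidean_space ^ 'n"
  assumes "\<And>i. (\<lambda>x. F x $ i) \<in> L2 \<Omega>" shows "F \<in> L2 \<Omega>"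
proof -
  have "(\<lambda>x. F x \<bullet> b) \<in> borel_measurable (lebesgue_on \<Omega>)" if "b \<in> Basis" for b
    using that L2_D(1)[OF assms] by (auto simp: Basis_vec_def inner_axis)
  then have "F \<in> borel_measurable (lebesgue_on \<Omega>)"
    by (subst borel_measurable_euclidean_space) auto
  moreover have "(norm (F x))\<^sup>2 = (\<Sum>i\<in>UNIV. (norm (F x $ i))\<^sup>2)" for x
    by (simp add: norm_vec_def L2_set_def sum_nonneg)
  ultimately show ?thesis using L2_D(2)[OF assms] by (simp add: L2_def)
qed

lemma L2_sum:
  assumes "finite I" "I \<noteq> {}" "\<And>i. i \<in> I \<Longrightarrow> F i \<in> L2 \<Omega>"
  shows "(\<lambda>x. \<Sum>i\<in>I. F i x) \<in> L2 \<Omega>"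
  using assms
proof (induction I rule: finite_ne_induct)
  case (insert i I)
  then show ?case using L2_comb[of "F i" \<Omega> "\<lambda>x. \<Sum>i\<in>I. F i x" 1 1] by simp
qed simp

text \<open>The bundle of facts that makes a differential operator usable in an \<open>L\<^sup>2\<close> form: values in \<open>L\<^sup>2\<close>
  and linearity up to null sets, on a domain closed under linear combinations.\<close>

definition ae_linear :: "'a::euclidean_space set \<Rightarrow> ('a \<Rightarrow> 'b::real_vector) set \<Rightarrow>
    (('a \<Rightarrow> 'b) \<Rightarrow> ('a \<Rightarrow> 'c::euclidean_space)) \<Rightarrow> bool" where
  "ae_linear \<Omega> V F \<longleftrightarrow>
     (\<forall>u\<in>V. F u \<in> L2 \<Omega>) \<and>
     (\<forall>u\<in>V. \<forall>v\<in>V. \<forall>a b. (\<lambda>x. a *\<^sub>R u x + b *\<^sub>R v x) \<in> V \<and>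
        (AE x in lebesgue_on \<Omega>. F (\<lambda>x. a *\<^sub>R u x + b *\<^sub>R v x) x = a *\<^sub>R F u x + b *\<^sub>R F v x))"

lemma ae_linear_inner:
  assumes F: "ae_linear \<Omega> V F" and u: "u \<in> V" and v: "v \<in> V" and w: "w \<in> L2 \<Omega>"
  shows "l2_inner \<Omega> (F (\<lambda>x. a *\<^sub>R u x + b *\<^sub>R v x)) w = a * l2_inner \<Omega> (F u) w + b * l2_inner \<Omega> (F v) w"
proof -
  have "l2_inner \<Omega> (F (\<lambda>x. a *\<^sub>R u x + b *\<^sub>R v x)) w = l2_inner \<Omega> (\<lambda>x. a *\<^sub>R F u x + b *\<^sub>R F v x) w"
    using F u v w by (intro l2_inner_cong_AE L2_comb) (auto simp: ae_linear_def)
  also have "\<dots> = a * l2_inner \<Omega> (F u) w + b * l2_inner \<Omega> (F v) w"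
    using F u v w by (intro psd_form.lin[OF l2_inner_psd]) (auto simp: ae_linear_def)
  finally show ?thesis .
qed

lemma ae_linear_psd:
  assumes F: "ae_linear \<Omega> V F" and c: "0 \<le> c"
  shows "psd_form V (\<lambda>u v. c * l2_inner \<Omega> (F u) (F v))"
proof
  show "c * l2_inner \<Omega> (F (\<lambda>x. a *\<^sub>R u x + b *\<^sub>R v x)) (F w)
      = a * (c * l2_inner \<Omega> (F u) (F w)) + b * (c * l2_inner \<Omega> (F v) (F w))"
    if "u \<in> V" "v \<in> V" "w \<in> V" for u v w a b
    using ae_linear_inner[OF F that(1,2), of "F w" a b] F that by (simp add: ae_linear_def algebra_simps)
  show "c * l2_inner \<Omega> (F u) (F v) = c * l2_inner \<Omega> (F v) (F u)" if "u \<in> V" "v \<in> V" for u v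
    by (simp add: l2_inner_def inner_commute)
  show "0 \<le> c * l2_inner \<Omega> (F u) (F u)" if "u \<in> V" for u
    using c by (simp add: l2_inner_def integral_nonneg)
qed (use F in \<open>simp add: ae_linear_def\<close>)

section \<open>Weak gradients\<close>

locale bounded_open_set =
  fixes \<Omega> :: "(real^'d) set"
  assumes \<Omega>_open: "open \<Omega>" and \<Omega>_bounded: "bounded \<Omega>"
begin

lemma continuous_in_L2:
  fixes \<phi> :: "real^'d \<Rightarrow> real"
  assumes "continuous_on UNIV \<phi>" shows "\<phi> \<in> L2 \<Omega>"
proof -
  have "\<Omega> \<in> lmeasurable"
    using \<Omega>_open \<Omega>_bounded by (intro bounded_set_imp_lmeasurable) auto
  then interpret finite_measure "lebesgue_on \<Omega>" by (rule finite_measure_lebesgue_on)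
  have img: "compact (\<phi> ` closure \<Omega>)"
    using \<Omega>_bounded by (intro compact_continuous_image continuous_on_subset[OF assms]) auto
  obtain K where K: "\<forall>y\<in>\<phi> ` closure \<Omega>. norm y \<le> K"
    using compact_imp_bounded[OF img] unfolding bounded_iff by blast
  have "\<phi> \<in> borel_measurable borel"
    using assms by (rule borel_measurable_continuous_onI)
  then have meas: "\<phi> \<in> borel_measurable (lebesgue_on \<Omega>)"
    by (simp add: measurable_completion measurable_restrict_space1)
  moreover have "integrable (lebesgue_on \<Omega>) (\<lambda>x. (norm (\<phi> x))\<^sup>2)"
  proof (rule integrable_const_bound[where B = "K\<^sup>2"])
    show "AE x in lebesgue_on \<Omega>. norm ((norm (\<phi> x))\<^sup>2) \<le> K\<^sup>2"
    proof (rule AE_I2)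
      fix x assume "x \<in> space (lebesgue_on \<Omega>)"
      then have "norm (\<phi> x) \<le> K" using K closure_subset by auto
      then show "norm ((norm (\<phi> x))\<^sup>2) \<le> K\<^sup>2" using power_mono[of "norm (\<phi> x)" K 2] by simp
    qed
  qed (use meas in measurable)
  ultimately show ?thesis by (simp add: L2_def)
qed

lemma test_function_in_L2:
  assumes "\<phi> \<in> test_functions \<Omega>"
  shows "\<phi> \<in> L2 \<Omega>" "partial_deriv j \<phi> \<in> L2 \<Omega>"
proof -
  have "Ck 0 \<phi>" "Ck (Suc 0) \<phi>" using assms by (auto simp only: test_functions_def mem_Collect_eq)
  then show "\<phi> \<in> L2 \<Omega>" "partial_deriv j \<phi> \<in> L2 \<Omega>" by (auto intro: continuous_in_L2)
qed

lemma is_weak_grad_inner: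
  "is_weak_grad \<Omega> u G \<longleftrightarrow> (\<forall>\<phi>\<in>test_functions \<Omega>. \<forall>j.
     l2_inner \<Omega> u (partial_deriv j \<phi>) = - l2_inner \<Omega> (\<lambda>x. G x $ j) \<phi>)"
  by (simp add: is_weak_grad_def l2_inner_def)

lemma is_weak_grad_comb:
  assumes "u \<in> L2 \<Omega>" "v \<in> L2 \<Omega>" "G \<in> L2 \<Omega>" "H \<in> L2 \<Omega>"
    and "is_weak_grad \<Omega> u G" "is_weak_grad \<Omega> v H"
  shows "is_weak_grad \<Omega> (\<lambda>x. a *\<^sub>R u x + b *\<^sub>R v x) (\<lambda>x. a *\<^sub>R G x + b *\<^sub>R H x)"
  unfolding is_weak_grad_inner
proof (intro ballI allI)
  fix \<phi> j assume \<phi>: "\<phi> \<in> test_functions \<Omega>"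
  note lin = psd_form.lin[OF l2_inner_psd]
  have "l2_inner \<Omega> (\<lambda>x. (a *\<^sub>R G x + b *\<^sub>R H x) $ j) \<phi>
      = l2_inner \<Omega> (\<lambda>x. a *\<^sub>R (G x $ j) + b *\<^sub>R (H x $ j)) \<phi>" by simp
  also have "\<dots> = a * l2_inner \<Omega> (\<lambda>x. G x $ j) \<phi> + b * l2_inner \<Omega> (\<lambda>x. H x $ j) \<phi>"
    by (intro lin L2_component test_function_in_L2 assms \<phi>)
  finally show "l2_inner \<Omega> (\<lambda>x. a *\<^sub>R u x + b *\<^sub>R v x) (partial_deriv j \<phi>)
      = - l2_inner \<Omega> (\<lambda>x. (a *\<^sub>R G x + b *\<^sub>R H x) $ j) \<phi>"
    using assms(5,6) \<phi> lin[OF assms(1,2) test_function_in_L2(2)[OF \<phi>], of a b j]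
    by (simp add: is_weak_grad_inner)
qed

text \<open>Each component of the difference is orthogonal to all test functions.\<close>

lemma weak_grad_unique:
  assumes G: "G \<in> L2 \<Omega>" "is_weak_grad \<Omega> u G" and H: "H \<in> L2 \<Omega>" "is_weak_grad \<Omega> u H"
  shows "AE x in lebesgue_on \<Omega>. G x = H x"
proof -
  have "AE x in lebesgue_on \<Omega>. 1 *\<^sub>R G x $ j + (-1) *\<^sub>R H x $ j = 0" for j
  proof (rule ae_zero_if_orthogonal_to_test_functions[OF \<Omega>_open])
    have D: "(\<lambda>x. 1 *\<^sub>R G x $ j + (-1) *\<^sub>R H x $ j) \<in> L2 \<Omega>"
      by (intro L2_comb L2_component G H)
    have one: "(\<lambda>x. 1 :: real) \<in> L2 \<Omega>" by (intro continuous_in_L2 continuous_on_const)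
    show "integrable (lebesgue_on \<Omega>) (\<lambda>x. 1 *\<^sub>R G x $ j + (-1) *\<^sub>R H x $ j)"
      using L2_integrable_inner[OF D one] by simp
    show "(LINT x|lebesgue_on \<Omega>. (1 *\<^sub>R G x $ j + (-1) *\<^sub>R H x $ j) * \<phi> x) = 0"
      if \<phi>: "\<phi> \<in> test_functions \<Omega>" for \<phi>
    proof -
      have "l2_inner \<Omega> (\<lambda>x. 1 *\<^sub>R G x $ j + (-1) *\<^sub>R H x $ j) \<phi>
          = 1 * l2_inner \<Omega> (\<lambda>x. G x $ j) \<phi> + (-1) * l2_inner \<Omega> (\<lambda>x. H x $ j) \<phi>"
        by (intro psd_form.lin[OF l2_inner_psd] L2_component G H test_function_in_L2 \<phi>)
      also have "\<dots> = 0"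
        using G(2) H(2) \<phi> by (simp add: is_weak_grad_inner)
      finally show ?thesis by (simp add: l2_inner_def)
    qed
  qed
  then have "AE x in lebesgue_on \<Omega>. \<forall>j\<in>UNIV. 1 *\<^sub>R G x $ j + (-1) *\<^sub>R H x $ j = 0"
    by (intro AE_finite_allI) auto
  then show ?thesis by eventually_elim (simp add: vec_eq_iff)
qed

lemma wgrad_props:
  assumes "u \<in> H1 \<Omega>"
  shows "wgrad \<Omega> u \<in> L2 \<Omega>" "is_weak_grad \<Omega> u (wgrad \<Omega> u)"
proof -
  have "\<exists>G. G \<in> L2 \<Omega> \<and> is_weak_grad \<Omega> u G" using assms by (auto simp: H1_def)
  from someI_ex[OF this] show "wgrad \<Omega> u \<in> L2 \<Omega>" "is_weak_grad \<Omega> u (wgrad \<Omega> u)"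
    by (auto simp: wgrad_def)
qed

text \<open>The combination of the chosen gradients is a weak gradient of the combination, hence agrees
  with the chosen one almost everywhere.\<close>

lemma wgrad_ae_linear: "ae_linear \<Omega> (H1 \<Omega>) (wgrad \<Omega>)"
  unfolding ae_linear_def
proof (intro conjI ballI allI wgrad_props)
  fix u v a b assume uv: "u \<in> H1 \<Omega>" "v \<in> H1 \<Omega>"
  then have L2: "u \<in> L2 \<Omega>" "v \<in> L2 \<Omega>" by (auto simp: H1_def)
  let ?w = "\<lambda>x. a *\<^sub>R u x + b *\<^sub>R v x" and ?G = "\<lambda>x. a *\<^sub>R wgrad \<Omega> u x + b *\<^sub>R wgrad \<Omega> v x"
  have G: "?G \<in> L2 \<Omega>" "is_weak_grad \<Omega> ?w ?G"
    by (intro L2_comb wgrad_props uv) (intro is_weak_grad_comb wgrad_props uv L2)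
  have "?w \<in> L2 \<Omega>" using L2 by (rule L2_comb)
  then show w: "?w \<in> H1 \<Omega>" using G unfolding H1_def by blast
  show "AE x in lebesgue_on \<Omega>. wgrad \<Omega> ?w x = ?G x"
    by (rule weak_grad_unique[OF wgrad_props[OF w] G])
qed

lemma wjac_ae_linear: "ae_linear \<Omega> (H1v \<Omega>) (wjac \<Omega>)"
  unfolding ae_linear_def
proof (intro conjI ballI allI)
  show "wjac \<Omega> u \<in> L2 \<Omega>" if "u \<in> H1v \<Omega>" for u
    using that by (intro L2_vec[of "wjac \<Omega> u"]) (simp add: wjac_def H1v_def wgrad_props(1))
  fix u v a b assume uv: "u \<in> H1v \<Omega>" "v \<in> H1v \<Omega>"
  let ?w = "\<lambda>x. a *\<^sub>R u x + b *\<^sub>R v x"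
  have comp: "(\<lambda>x. ?w x $ i) = (\<lambda>x. a *\<^sub>R (u x $ i) + b *\<^sub>R (v x $ i))" for i by simp
  have uvi: "(\<lambda>x. u x $ i) \<in> H1 \<Omega>" "(\<lambda>x. v x $ i) \<in> H1 \<Omega>" for i using uv by (auto simp: H1v_def)
  show "?w \<in> H1v \<Omega>"
    unfolding H1v_def mem_Collect_eq comp using uvi wgrad_ae_linear by (auto simp: ae_linear_def)
  have "AE x in lebesgue_on \<Omega>. \<forall>i\<in>UNIV. wgrad \<Omega> (\<lambda>x. ?w x $ i) x
      = a *\<^sub>R wgrad \<Omega> (\<lambda>x. u x $ i) x + b *\<^sub>R wgrad \<Omega> (\<lambda>x. v x $ i) x"
    unfolding comp using uvi wgrad_ae_linear by (intro AE_finite_allI) (auto simp: ae_linear_def)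
  then show "AE x in lebesgue_on \<Omega>. wjac \<Omega> ?w x = a *\<^sub>R wjac \<Omega> u x + b *\<^sub>R wjac \<Omega> v x"
    by eventually_elim (auto simp: wjac_def vec_eq_iff)
qed

lemma strain_ae_linear: "ae_linear \<Omega> (H1v \<Omega>) (strain \<Omega>)"
  unfolding ae_linear_def
proof (intro conjI ballI allI)
  fix u assume "u \<in> H1v \<Omega>"
  then have J: "wjac \<Omega> u \<in> L2 \<Omega>" using wjac_ae_linear by (auto simp: ae_linear_def)
  have "(\<lambda>x. transpose (wjac \<Omega> u x)) \<in> L2 \<Omega>"
    unfolding transpose_def by (intro L2_vec) (simp add: L2_component J)
  then have "(\<lambda>x. (1/2) *\<^sub>R wjac \<Omega> u x + (1/2) *\<^sub>R transpose (wjac \<Omega> u x)) \<in> L2 \<Omega>"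
    by (intro L2_comb J)
  then show "strain \<Omega> u \<in> L2 \<Omega>" 
    by (simp add: strain_def[abs_def] scaleR_add_right)
next
  fix u v a b assume uv: "u \<in> H1v \<Omega>" "v \<in> H1v \<Omega>"
  let ?w = "\<lambda>x. a *\<^sub>R u x + b *\<^sub>R v x"
  show "?w \<in> H1v \<Omega>" using uv wjac_ae_linear by (auto simp: ae_linear_def)
  have "AE x in lebesgue_on \<Omega>. wjac \<Omega> ?w x = a *\<^sub>R wjac \<Omega> u x + b *\<^sub>R wjac \<Omega> v x"
    using uv wjac_ae_linear by (auto simp: ae_linear_def)
  then show "AE x in lebesgue_on \<Omega>. strain \<Omega> ?w x = a *\<^sub>R strain \<Omega> u x + b *\<^sub>R strain \<Omega> v x"
    by eventually_elim (simp add: strain_def vec_eq_iff transpose_def algebra_simps)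
qed

lemma wdiv_ae_linear: "ae_linear \<Omega> (H1v \<Omega>) (wdiv \<Omega>)"
  unfolding ae_linear_def
proof (intro conjI ballI allI)
  show "wdiv \<Omega> u \<in> L2 \<Omega>" if "u \<in> H1v \<Omega>" for u
    using that wjac_ae_linear unfolding wdiv_def[abs_def] trace_def
    by (intro L2_sum L2_component) (auto simp: ae_linear_def)
  fix u v a b assume uv: "u \<in> H1v \<Omega>" "v \<in> H1v \<Omega>"
  let ?w = "\<lambda>x. a *\<^sub>R u x + b *\<^sub>R v x"
  show "?w \<in> H1v \<Omega>" using uv wjac_ae_linear by (auto simp: ae_linear_def)
  have "AE x in lebesgue_on \<Omega>. wjac \<Omega> ?w x = a *\<^sub>R wjac \<Omega> u x + b *\<^sub>R wjac \<Omega> v x"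
    using uv wjac_ae_linear by (auto simp: ae_linear_def)
  then show "AE x in lebesgue_on \<Omega>. wdiv \<Omega> ?w x = a *\<^sub>R wdiv \<Omega> u x + b *\<^sub>R wdiv \<Omega> v x"
    by eventually_elim (simp add: wdiv_def trace_def sum.distrib sum_distrib_left)
qed

lemma form_a1_psd: "0 \<le> \<mu> \<Longrightarrow> psd_form (H1v \<Omega>) (form_a1 \<Omega> \<mu>)"
  using ae_linear_psd[OF strain_ae_linear, of "2 * \<mu>"] by (simp add: form_a1_def[abs_def])

lemma form_d_psd: "0 \<le> kp \<Longrightarrow> real_psd_form (H1 \<Omega>) (form_d \<Omega> kp)"
  using ae_linear_psd[OF wgrad_ae_linear, of kp] 
  by (simp add: form_d_def[abs_def] real_psd_form_def)

text \<open>Symmetrising the Jacobian does not increase its Frobenius norm.\<close>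

lemma form_a1_le_h1_norm:
  assumes \<mu>: "0 \<le> \<mu>" and v: "v \<in> H1v \<Omega>"
  shows "form_a1 \<Omega> \<mu> v v \<le> 2 * \<mu> * (h1_norm \<Omega> v)\<^sup>2"
proof -
  have J: "wjac \<Omega> v \<in> L2 \<Omega>" and S: "strain \<Omega> v \<in> L2 \<Omega>"
    using v wjac_ae_linear strain_ae_linear by (auto simp: ae_linear_def)
  have tr: "norm (transpose A) = norm A" for A :: "real^'d^'d"
    unfolding norm_eq_sqrt_inner inner_vec_def transpose_def vec_lambda_beta
    by (subst sum.swap) (rule refl)
  have le: "norm (strain \<Omega> v x) \<le> norm (wjac \<Omega> v x)" for x
    using norm_triangle_ineq[of "wjac \<Omega> v x" "transpose (wjac \<Omega> v x)"]
    by (simp add: strain_def tr)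
  have "l2_inner \<Omega> (strain \<Omega> v) (strain \<Omega> v) \<le> l2_inner \<Omega> (wjac \<Omega> v) (wjac \<Omega> v)"
    unfolding l2_inner_def
    by (intro integral_mono L2_integrable_inner J S) (simp add: le flip: power2_norm_eq_inner)
  also have "\<dots> \<le> h1_inner \<Omega> v v"
    by (simp add: h1_inner_def l2_inner_def integral_nonneg)
  also have "\<dots> = (h1_norm \<Omega> v)\<^sup>2"
    by (simp add: h1_norm_def h1_inner_def l2_inner_def integral_nonneg)
  finally show ?thesis
    using \<mu> by (simp add: form_a1_def mult_left_mono)
qed

end

section \<open>Finite element spaces\<close>

lemma poly_on_comb:
  assumes "poly_on k E u" "poly_on k E v" shows "poly_on k E (\<lambda>x. a *\<^sub>R u x + b *\<^sub>R v x)"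
proof -
  let ?M = "{m :: 'a \<Rightarrow> nat. sum m UNIV \<le> k}"
  obtain c where c: "\<forall>x\<in>E. u x = (\<Sum>m\<in>?M. c m * (\<Prod>j\<in>UNIV. (x $ j) ^ m j))"
    using assms(1) unfolding poly_on_def by blast
  obtain d where d: "\<forall>x\<in>E. v x = (\<Sum>m\<in>?M. d m * (\<Prod>j\<in>UNIV. (x $ j) ^ m j))"
    using assms(2) unfolding poly_on_def by blast
  show ?thesis
    unfolding poly_on_def
    by (intro exI[of _ "\<lambda>m. a * c m + b * d m"])
       (simp add: c d sum_distrib_left distrib_right sum.distrib mult.assoc)
qed

lemma Wh_comb:
  assumes "u \<in> Wh \<Omega> \<T> k" "v \<in> Wh \<Omega> \<T> k"
  shows "(\<lambda>x. a *\<^sub>R u x + b *\<^sub>R v x) \<in> Wh \<Omega> \<T> k"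
proof -
  have "(\<lambda>x. a *\<^sub>R u x + b *\<^sub>R v x) \<in> L2 \<Omega>"
    using assms by (intro L2_comb) (auto simp: Wh_def)
  moreover have "poly_on (k - 1) E (\<lambda>x. a *\<^sub>R u x + b *\<^sub>R v x)" if "E \<in> \<T>" for E
    using assms that by (intro poly_on_comb) (auto simp: Wh_def)
  ultimately show ?thesis
    using assms by (auto simp: Wh_def intro!: continuous_intros)
qed

context bounded_open_set
begin

lemma Vh_comb:
  assumes "u \<in> Vh \<Omega> \<Gamma> \<T> k" "v \<in> Vh \<Omega> \<Gamma> \<T> k"
  shows "(\<lambda>x. a *\<^sub>R u x + b *\<^sub>R v x) \<in> Vh \<Omega> \<Gamma> \<T> k"
proof -
  have "(\<lambda>x. a *\<^sub>R u x + b *\<^sub>R v x) \<in> H1v \<Omega>"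
    using assms wjac_ae_linear by (auto simp: Vh_def ae_linear_def)
  moreover have "poly_on k E (\<lambda>x. (a *\<^sub>R u x + b *\<^sub>R v x) $ i)" if "E \<in> \<T>" for E i
    using assms that poly_on_comb[of k E "\<lambda>x. u x $ i" "\<lambda>x. v x $ i" a b] by (simp add: Vh_def)
  ultimately show ?thesis
    using assms by (auto simp: Vh_def intro!: continuous_intros)
qed

lemma Mh_comb:
  assumes "u \<in> Mh \<Omega> \<Gamma> \<T> k" "v \<in> Mh \<Omega> \<Gamma> \<T> k"
  shows "(\<lambda>x. a *\<^sub>R u x + b *\<^sub>R v x) \<in> Mh \<Omega> \<Gamma> \<T> k"
proof -
  have "(\<lambda>x. a *\<^sub>R u x + b *\<^sub>R v x) \<in> H1 \<Omega>"
    using assms wgrad_ae_linear by (auto simp: Mh_def ae_linear_def)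
  moreover have "poly_on k E (\<lambda>x. a *\<^sub>R u x + b *\<^sub>R v x)" if "E \<in> \<T>" for E
    using assms that by (intro poly_on_comb) (auto simp: Mh_def)
  ultimately show ?thesis
    using assms by (auto simp: Mh_def intro!: continuous_intros)
qed

end

section \<open>The full-order problems\<close>

text \<open>Errors and their BDF-2 quotients have to be admissible test functions: this is what closure under
  linear combinations is for.\<close>

locale discrete_spaces = bounded_open_set \<Omega>
  for \<Omega> :: "(real^'d) set" +
  fixes V :: "(real^'d \<Rightarrow> real^'d) set" and W M :: "(real^'d \<Rightarrow> real) set"
  assumes V_H1v: "V \<subseteq> H1v \<Omega>" and W_L2: "W \<subseteq> L2 \<Omega>" and M_H1: "M \<subseteq> H1 \<Omega>"
    and V_comb: "\<And>u v a b. u \<in> V \<Longrightarrow> v \<in> V \<Longrightarrow> (\<lambda>x. a *\<^sub>R u x + b *\<^sub>R v x) \<in> V"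
    and W_comb: "\<And>u v a b. u \<in> W \<Longrightarrow> v \<in> W \<Longrightarrow> (\<lambda>x. a *\<^sub>R u x + b *\<^sub>R v x) \<in> W"
    and M_comb: "\<And>u v a b. u \<in> M \<Longrightarrow> v \<in> M \<Longrightarrow> (\<lambda>x. a *\<^sub>R u x + b *\<^sub>R v x) \<in> M"
begin

lemma M_L2: "q \<in> M \<Longrightarrow> q \<in> L2 \<Omega>"
  using M_H1 by (auto simp: H1_def)

lemma wdiv_L2: "v \<in> V \<Longrightarrow> wdiv \<Omega> v \<in> L2 \<Omega>"
  using V_H1v wdiv_ae_linear by (auto simp: ae_linear_def)

text \<open>The load of the combination is specified only through its pairing with \<open>V\<close>, so that the lemma covers
  both a difference of two solutions with the same load, which cancels, and combinations of
  solutions with zero load.\<close>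

lemma mixed_solution_comb:
  assumes \<mu>: "0 \<le> \<mu>" and p: "p1 \<in> L2 \<Omega>" "p2 \<in> L2 \<Omega>"
    and s1: "mixed_solution \<Omega> lam \<mu> \<alpha> V W F1 p1 u1 \<xi>1"
    and s2: "mixed_solution \<Omega> lam \<mu> \<alpha> V W F2 p2 u2 \<xi>2"
    and F: "\<And>v. v \<in> V \<Longrightarrow> l2_inner \<Omega> F v = a * l2_inner \<Omega> F1 v + b * l2_inner \<Omega> F2 v"
  shows "mixed_solution \<Omega> lam \<mu> \<alpha> V W F (\<lambda>x. a *\<^sub>R p1 x + b *\<^sub>R p2 x)
    (\<lambda>x. a *\<^sub>R u1 x + b *\<^sub>R u2 x) (\<lambda>x. a *\<^sub>R \<xi>1 x + b *\<^sub>R \<xi>2 x)"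
proof -
  have u: "u1 \<in> V" "u2 \<in> V" and \<xi>: "\<xi>1 \<in> W" "\<xi>2 \<in> W"
    using s1 s2 by (auto simp: mixed_solution_def)
  have uH: "u1 \<in> H1v \<Omega>" "u2 \<in> H1v \<Omega>" and \<xi>L: "\<xi>1 \<in> L2 \<Omega>" "\<xi>2 \<in> L2 \<Omega>"
    using u \<xi> V_H1v W_L2 by auto
  note lin = psd_form.lin[OF l2_inner_psd]
  have "form_a1 \<Omega> \<mu> (\<lambda>x. a *\<^sub>R u1 x + b *\<^sub>R u2 x) v - form_b \<Omega> v (\<lambda>x. a *\<^sub>R \<xi>1 x + b *\<^sub>R \<xi>2 x)
      = l2_inner \<Omega> F v" if v: "v \<in> V" for v
  proof -
    have "form_a1 \<Omega> \<mu> (\<lambda>x. a *\<^sub>R u1 x + b *\<^sub>R u2 x) v = a * form_a1 \<Omega> \<mu> u1 v + b * form_a1 \<Omega> \<mu> u2 v"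
      using v V_H1v by (intro psd_form.lin[OF form_a1_psd] \<mu> uH) auto
    moreover have "form_b \<Omega> v (\<lambda>x. a *\<^sub>R \<xi>1 x + b *\<^sub>R \<xi>2 x) = a * form_b \<Omega> v \<xi>1 + b * form_b \<Omega> v \<xi>2"
      unfolding form_b_def by (intro lin \<xi>L wdiv_L2 v)
    moreover have "form_a1 \<Omega> \<mu> u1 v = form_b \<Omega> v \<xi>1 + l2_inner \<Omega> F1 v"
      "form_a1 \<Omega> \<mu> u2 v = form_b \<Omega> v \<xi>2 + l2_inner \<Omega> F2 v"
      using s1 s2 v by (auto simp: mixed_solution_def algebra_simps)
    ultimately show ?thesis by (simp add: F[OF v] algebra_simps)
  qed
  moreover have "form_b \<Omega> (\<lambda>x. a *\<^sub>R u1 x + b *\<^sub>R u2 x) w + form_a2 \<Omega> lam (\<lambda>x. a *\<^sub>R \<xi>1 x + b *\<^sub>R \<xi>2 x) w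
      = form_c \<Omega> lam \<alpha> (\<lambda>x. a *\<^sub>R p1 x + b *\<^sub>R p2 x) w" if w: "w \<in> W" for w
  proof -
    have wL: "w \<in> L2 \<Omega>" using w W_L2 by auto
    have "form_b \<Omega> (\<lambda>x. a *\<^sub>R u1 x + b *\<^sub>R u2 x) w = a * form_b \<Omega> u1 w + b * form_b \<Omega> u2 w"
      using ae_linear_inner[OF wdiv_ae_linear uH wL] by (simp add: form_b_def l2_inner_commute[of \<Omega> w])
    moreover have "form_b \<Omega> u1 w + form_a2 \<Omega> lam \<xi>1 w = form_c \<Omega> lam \<alpha> p1 w"
      "form_b \<Omega> u2 w + form_a2 \<Omega> lam \<xi>2 w = form_c \<Omega> lam \<alpha> p2 w"
      using s1 s2 w by (auto simp: mixed_solution_def)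
    then have "form_b \<Omega> u1 w = form_c \<Omega> lam \<alpha> p1 w - form_a2 \<Omega> lam \<xi>1 w"
      "form_b \<Omega> u2 w = form_c \<Omega> lam \<alpha> p2 w - form_a2 \<Omega> lam \<xi>2 w"
      by simp_all
    ultimately show ?thesis
      unfolding form_a2_def form_c_def lin[OF \<xi>L wL] lin[OF p wL] by (simp add: algebra_simps)
  qed
  ultimately show ?thesis
    using V_comb[OF u] W_comb[OF \<xi>] by (simp only: mixed_solution_def) blast
qed

text \<open>By linearity the BDF-2 quotients of solutions with zero load are again such solutions. At the first
  two time levels \<open>u\<close> is not constrained; the zero function serves as displacement there.\<close>

lemma mixed_solution_bdf2:
  assumes \<mu>: "0 \<le> \<mu>"
    and p: "\<And>n. n \<le> N \<Longrightarrow> p n \<in> L2 \<Omega>"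
    and sol: "\<And>n. n \<in> {2..N} \<Longrightarrow> mixed_solution \<Omega> lam \<mu> \<alpha> V W (\<lambda>x. 0) (p n) (u n) (\<xi> n)"
    and zero: "\<And>n. n < 2 \<Longrightarrow> p n = (\<lambda>x. 0)" "\<And>n. n < 2 \<Longrightarrow> \<xi> n = (\<lambda>x. 0)"
    and n: "n \<in> {2..N}"
  shows "\<exists>w. mixed_solution \<Omega> lam \<mu> \<alpha> V W (\<lambda>x. 0) (bdf2 dt p n) w (bdf2 dt \<xi> n)"
proof -
  note comb = mixed_solution_comb[where F = "\<lambda>x. 0" and ?F1.0 = "\<lambda>x. 0" and ?F2.0 = "\<lambda>x. 0",
    unfolded l2_inner_zero, OF \<mu>]
  have "\<exists>w. mixed_solution \<Omega> lam \<mu> \<alpha> V W (\<lambda>x. 0) (p m) w (\<xi> m)" if "m \<le> N" for m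
  proof (cases "m < 2")
    case True
    have "mixed_solution \<Omega> lam \<mu> \<alpha> V W (\<lambda>x. 0) (\<lambda>x. 0 *\<^sub>R p n x + 0 *\<^sub>R p n x)
        (\<lambda>x. 0 *\<^sub>R u n x + 0 *\<^sub>R u n x) (\<lambda>x. 0 *\<^sub>R \<xi> n x + 0 *\<^sub>R \<xi> n x)"
      using n by (intro comb sol p) auto
    then show ?thesis using zero[OF True] by auto
  next
    case False
    then show ?thesis using sol[of m] that by auto
  qed
  then obtain U where U: "\<And>m. m \<le> N \<Longrightarrow> mixed_solution \<Omega> lam \<mu> \<alpha> V W (\<lambda>x. 0) (p m) (U m) (\<xi> m)"
    by metis
  show ?thesis
    unfolding bdf2_eq_comb using n 
    by (intro exI[where x = "\<lambda>x. 1 *\<^sub>R ((3/2/dt) *\<^sub>R U n x + (-2/dt) *\<^sub>R U (n - 1) x) + (1/2/dt) *\<^sub>R U (n - 2) x"]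
        comb U p L2_comb) auto
qed

text \<open>With zero load, \<open>b(v, \<xi>) = a\<^sub>1(u, v) \<le> a\<^sub>1(u, u)^(1/2) (2 \<mu>)^(1/2) \<parallel>v\<parallel>\<close>, so the inf-sup condition gives
  \<open>\<beta>\<^sup>2 / (2 \<mu>) \<parallel>\<xi>\<parallel>\<^sup>2 \<le> a\<^sub>1(u, u)\<close>. Adding this to the energy identity
  \<open>a\<^sub>1(u, u) + \<parallel>\<xi>\<parallel>\<^sup>2 / \<lambda> = \<alpha> / \<lambda> (p, \<xi>)\<close> bounds \<open>\<xi>\<close> by \<open>p\<close>.\<close>

lemma mixed_solution_stable:
  assumes pos: "0 < lam" "0 < \<mu>" "0 < \<alpha>" "0 < \<beta>"
    and infsup: "inf_sup_condition \<Omega> V W \<beta>"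
    and p: "p \<in> L2 \<Omega>"
    and sol: "mixed_solution \<Omega> lam \<mu> \<alpha> V W (\<lambda>x. 0) p u \<xi>"
  shows "l2_norm \<Omega> \<xi> \<le> \<alpha> / (\<beta>\<^sup>2 / (2 * \<mu>) * lam + 1) * l2_norm \<Omega> p"
proof -
  have u: "u \<in> V" and \<xi>: "\<xi> \<in> W" using sol by (auto simp: mixed_solution_def)
  have uH: "u \<in> H1v \<Omega>" and \<xi>L: "\<xi> \<in> L2 \<Omega>" using u \<xi> V_H1v W_L2 by auto
  interpret a1: psd_form "H1v \<Omega>" "form_a1 \<Omega> \<mu>" using pos by (intro form_a1_psd) simp
  define A where "A = form_a1 \<Omega> \<mu> u u"
  have A: "0 \<le> A" unfolding A_def by (rule a1.nonneg[OF uH])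
  have momentum: "form_a1 \<Omega> \<mu> u v = form_b \<Omega> v \<xi>" if "v \<in> V" for v
    using sol that by (simp add: mixed_solution_def l2_inner_zero)
  have "form_b \<Omega> v \<xi> / h1_norm \<Omega> v \<le> sqrt (2 * \<mu> * A)" if v: "v \<in> V" for v
  proof -
    have vH: "v \<in> H1v \<Omega>" using v V_H1v by auto
    have h: "0 \<le> h1_norm \<Omega> v"
      by (simp add: h1_norm_def h1_inner_def l2_inner_def integral_nonneg)
    have "form_b \<Omega> v \<xi> \<le> sqrt A * sqrt (form_a1 \<Omega> \<mu> v v)"
      using a1.cauchy_schwarz_sqrt[OF uH vH] momentum[OF v] by (simp add: A_def)
    also have "\<dots> \<le> sqrt A * sqrt (2 * \<mu> * (h1_norm \<Omega> v)\<^sup>2)"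
      using form_a1_le_h1_norm[OF _ vH, of \<mu>] pos A by (intro mult_left_mono) auto
    also have "\<dots> = sqrt (2 * \<mu> * A) * h1_norm \<Omega> v"
      using h by (simp add: real_sqrt_mult)
    finally show ?thesis
      using h pos A by (cases "h1_norm \<Omega> v = 0") (auto simp: field_simps)
  qed
  then have "(SUP v\<in>{v\<in>V. \<exists>x\<in>\<Omega>. v x \<noteq> 0}. ereal (form_b \<Omega> v \<xi> / h1_norm \<Omega> v)) \<le> ereal (sqrt (2 * \<mu> * A))"
    by (intro SUP_least) auto
  then have "ereal (\<beta> * l2_norm \<Omega> \<xi>) \<le> ereal (sqrt (2 * \<mu> * A))"
    using infsup \<xi> unfolding inf_sup_condition_def by (meson order_trans)
  then have "(\<beta> * l2_norm \<Omega> \<xi>)\<^sup>2 \<le> (sqrt (2 * \<mu> * A))\<^sup>2"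
    using pos l2_norm_nonneg[of \<Omega> \<xi>] by (intro power_mono) auto
  then have lower: "\<beta>\<^sup>2 / (2 * \<mu>) * (l2_norm \<Omega> \<xi>)\<^sup>2 \<le> A"
    using pos A by (simp add: power_mult_distrib field_simps)
  have "A + 1 / lam * (l2_norm \<Omega> \<xi>)\<^sup>2 = \<alpha> / lam * l2_inner \<Omega> p \<xi>"
    using sol u \<xi> momentum[OF u]
    by (auto simp: A_def mixed_solution_def form_a2_def form_c_def l2_norm_power2)
  also have "\<dots> \<le> \<alpha> / lam * (l2_norm \<Omega> p * l2_norm \<Omega> \<xi>)"
    using psd_form.cauchy_schwarz_sqrt[OF l2_inner_psd p \<xi>L] pos
    by (intro mult_left_mono) (auto simp: l2_norm_def)
  finally have "(\<beta>\<^sup>2 / (2 * \<mu>) + 1 / lam) * (l2_norm \<Omega> \<xi>)\<^sup>2 \<le> \<alpha> / lam * (l2_norm \<Omega> p * l2_norm \<Omega> \<xi>)"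
    using lower by (simp add: distrib_right)
  then have "lam * ((\<beta>\<^sup>2 / (2 * \<mu>) + 1 / lam) * (l2_norm \<Omega> \<xi>)\<^sup>2)
      \<le> lam * (\<alpha> / lam * (l2_norm \<Omega> p * l2_norm \<Omega> \<xi>))"
    using pos by (intro mult_left_mono) auto
  then have main: "l2_norm \<Omega> \<xi> * ((\<beta>\<^sup>2 / (2 * \<mu>) * lam + 1) * l2_norm \<Omega> \<xi>) \<le> l2_norm \<Omega> \<xi> * (\<alpha> * l2_norm \<Omega> p)"
    using pos by (simp add: power2_eq_square algebra_simps)
  have D: "0 < \<beta>\<^sup>2 / (2 * \<mu>) * lam + 1" using pos by (intro add_nonneg_pos) auto
  have "(\<beta>\<^sup>2 / (2 * \<mu>) * lam + 1) * l2_norm \<Omega> \<xi> \<le> \<alpha> * l2_norm \<Omega> p"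
  proof (cases "l2_norm \<Omega> \<xi> = 0")
    case True
    then show ?thesis using pos l2_norm_nonneg[of \<Omega> p] by simp
  next
    case False
    then have "0 < l2_norm \<Omega> \<xi>" using l2_norm_nonneg[of \<Omega> \<xi>] by simp
    with main show ?thesis by (rule mult_left_le_imp_le)
  qed
  then show ?thesis using D by (simp add: pos_le_divide_eq mult.commute)
qed

text \<open>Test the flow equation with \<open>D e n\<close> and sum over \<open>n\<close>: the diffusion terms add up to a nonnegative
  number, and Young's inequality absorbs half of \<open>\<kappa> \<parallel>D e\<parallel>\<^sup>2\<close> on the left.\<close>

lemma pressure_error_bound:
  assumes pos: "0 < lam" "0 < \<alpha>" "0 \<le> c0" "0 \<le> kp" "0 < dt"
    and e: "\<And>n. n \<le> N \<Longrightarrow> e n \<in> M" and zero: "\<And>n. n < 2 \<Longrightarrow> e n = (\<lambda>x. 0)"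
    and z: "\<And>n. n \<in> {2..N} \<Longrightarrow> z n \<in> L2 \<Omega>"
    and eq: "\<And>n q. n \<in> {2..N} \<Longrightarrow> q \<in> M \<Longrightarrow>
      form_a3 \<Omega> lam \<alpha> c0 (bdf2 dt e n) q + form_d \<Omega> kp (e n) q = form_c \<Omega> lam \<alpha> q (z n)"
  shows "(\<Sum>n=2..N. (l2_norm \<Omega> (bdf2 dt e n))\<^sup>2)
    \<le> (1 / (\<alpha> * (c0 * lam / \<alpha>\<^sup>2 + 1)))\<^sup>2 * (\<Sum>n=2..N. (l2_norm \<Omega> (z n))\<^sup>2)"
proof -
  interpret d: real_psd_form "H1 \<Omega>" "form_d \<Omega> kp" using pos by (intro form_d_psd)
  define \<kappa> where "\<kappa> = c0 + \<alpha>\<^sup>2 / lam"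
  have \<kappa>: "0 < \<kappa>" using pos by (auto simp: \<kappa>_def intro: add_nonneg_pos)
  have D: "bdf2 dt e n \<in> M" if "n \<in> {2..N}" for n
    unfolding bdf2_eq_comb using that by (intro M_comb e) auto
  let ?y = "\<lambda>n. (l2_norm \<Omega> (bdf2 dt e n))\<^sup>2" and ?z = "\<lambda>n. (l2_norm \<Omega> (z n))\<^sup>2"
  let ?d = "\<lambda>n. form_d \<Omega> kp (e n) (bdf2 dt e n)"
  have step: "\<kappa> / 2 * ?y n + ?d n \<le> (\<alpha> / lam)\<^sup>2 / (2 * \<kappa>) * ?z n" if n: "n \<in> {2..N}" for n
  proof -
    \<comment> \<open>The weight that, after multiplication by \<open>\<alpha> / (2 \<lambda>)\<close>, leaves exactly \<open>\<kappa> / 2\<close>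
      in front of the first square.\<close>
    have "2 * l2_inner \<Omega> (bdf2 dt e n) (z n) \<le> (\<kappa> * lam / \<alpha>) * ?y n + ?z n / (\<kappa> * lam / \<alpha>)"
      unfolding l2_norm_power2
      using pos \<kappa> by (intro psd_form.young[OF l2_inner_psd] M_L2 D z n) auto
    then have "\<alpha> / (2 * lam) * (2 * l2_inner \<Omega> (bdf2 dt e n) (z n))
        \<le> \<alpha> / (2 * lam) * ((\<kappa> * lam / \<alpha>) * ?y n + ?z n / (\<kappa> * lam / \<alpha>))"
      using pos by (intro mult_left_mono) auto
    also have "\<dots> = \<kappa> / 2 * ?y n + (\<alpha> / lam)\<^sup>2 / (2 * \<kappa>) * ?z n"
      using pos \<kappa> by (simp add: field_simps power2_eq_square)
    finally have "\<alpha> / lam * l2_inner \<Omega> (bdf2 dt e n) (z n) \<le> \<kappa> / 2 * ?y n + (\<alpha> / lam)\<^sup>2 / (2 * \<kappa>) * ?z n"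
      by simp
    moreover have "\<kappa> * ?y n + ?d n = \<alpha> / lam * l2_inner \<Omega> (bdf2 dt e n) (z n)"
      using eq[OF n D[OF n]] by (simp add: form_a3_def form_c_def \<kappa>_def l2_norm_power2)
    ultimately show ?thesis by simp
  qed
  have "0 \<le> (\<Sum>n=2..N. ?d n)"
    using M_H1 e zero pos by (intro d.bdf2_sum_nonneg) auto
  then have "\<kappa> / 2 * (\<Sum>n=2..N. ?y n) \<le> (\<Sum>n=2..N. \<kappa> / 2 * ?y n + ?d n)"
    by (simp add: sum.distrib sum_distrib_left)
  also have "\<dots> \<le> (\<alpha> / lam)\<^sup>2 / (2 * \<kappa>) * (\<Sum>n=2..N. ?z n)"
    unfolding sum_distrib_left by (intro sum_mono step)
  finally have "2 / \<kappa> * (\<kappa> / 2 * (\<Sum>n=2..N. ?y n)) \<le> 2 / \<kappa> * ((\<alpha> / lam)\<^sup>2 / (2 * \<kappa>) * (\<Sum>n=2..N. ?z n))"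
    using \<kappa> by (intro mult_left_mono) auto
  then have "(\<Sum>n=2..N. ?y n) \<le> (\<alpha> / (lam * \<kappa>))\<^sup>2 * (\<Sum>n=2..N. ?z n)"
    using \<kappa> pos by (simp add: field_simps power2_eq_square)
  moreover have "\<alpha> / (lam * \<kappa>) = 1 / (\<alpha> * (c0 * lam / \<alpha>\<^sup>2 + 1))"
  proof -
    have "lam * \<kappa> = \<alpha>\<^sup>2 * (c0 * lam / \<alpha>\<^sup>2 + 1)"
      using pos by (simp add: \<kappa>_def field_simps)
    then show ?thesis using pos by (simp add: power2_eq_square)
  qed
  ultimately show ?thesis by simp
qed

end

section \<open>The reduced-order iteration\<close>

lemma comb_closed_sum:
  fixes W :: "('a \<Rightarrow> 'b::real_vector) set"
  assumes comb: "\<And>u v a b. u \<in> W \<Longrightarrow> v \<in> W \<Longrightarrow> (\<lambda>x. a *\<^sub>R u x + b *\<^sub>R v x) \<in> W"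
    and ne: "W \<noteq> {}" and I: "finite I" and f: "\<And>i. i \<in> I \<Longrightarrow> f i \<in> W"
  shows "(\<lambda>x. \<Sum>i\<in>I. c i *\<^sub>R f i x) \<in> W"
  using I f
proof (induction I rule: finite_induct)
  case empty
  obtain w where "w \<in> W" using ne by blast
  then show ?case using comb[of w w 0 0] by simp
next
  case (insert i I)
  then show ?case using comb[of "f i" "\<lambda>x. \<Sum>i\<in>I. c i *\<^sub>R f i x" "c i" 1] by simp
qed

text \<open>POD modes are linear combinations of snapshots. The inclusion makes the reduced iterates elements of the
  full-order space, in particular square integrable.\<close>

lemma is_pod_space_subset:
  fixes W :: "('a \<Rightarrow> 'b::real_vector) set"
  assumes comb: "\<And>u v a b. u \<in> W \<Longrightarrow> v \<in> W \<Longrightarrow> (\<lambda>x. a *\<^sub>R u x + b *\<^sub>R v x) \<in> W"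
    and pod: "is_pod_space ip L \<phi> Nr S" and L: "0 < L" and \<phi>: "\<And>i. i < L \<Longrightarrow> \<phi> i \<in> W"
  shows "S \<subseteq> W"
proof -
  have ne: "W \<noteq> {}" using L \<phi> by blast
  note sum = comb_closed_sum[OF comb ne]
  have mode: "pod_mode L \<phi> \<gamma> v n \<in> W" for \<gamma> v n
  proof -
    have "pod_mode L \<phi> \<gamma> v n = (\<lambda>x. \<Sum>i<L. (\<gamma> n powr (-1/2) * v n i) *\<^sub>R \<phi> i x)"
      by (simp add: pod_mode_def fun_eq_iff scaleR_sum_right)
    also have "\<dots> \<in> W" by (intro sum \<phi>) auto
    finally show ?thesis .
  qed
  have "(\<lambda>x. \<Sum>n<Nr. a n *\<^sub>R pod_mode L \<phi> \<gamma> v n x) \<in> W" for a \<gamma> v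
    by (intro sum mode) auto
  then show ?thesis using pod by (auto simp: is_pod_space_def)
qed

lemma xi_error_eq:
  assumes "\<And>n. n < 2 \<Longrightarrow> \<xi> n i = \<xi>h n"
  shows "(\<lambda>m. xi_error \<xi> \<xi>h m i) = (\<lambda>m x. 1 *\<^sub>R \<xi> m i x + (-1) *\<^sub>R \<xi>h m x)"
  using assms by (auto simp: xi_error_def fun_eq_iff)

context discrete_spaces
begin

text \<open>The full-order solutions of the \<open>i\<close>-th sweep depend on the previous iterate only through the flow
  equation; the two stability estimates are applied one after the other.\<close>

lemma full_order_contraction:
  assumes pos: "0 < lam" "0 < \<mu>" "0 < \<alpha>" "0 \<le> c0" "0 < kp" "0 < \<beta>" "0 < dt"
    and infsup: "inf_sup_condition \<Omega> V W \<beta>"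
    and mono: "monolithic_bdf2 \<Omega> lam \<mu> \<alpha> c0 kp V W M f g dt N uh \<xi>h ph"
    and rom: "rom_algorithm \<Omega> lam \<mu> \<alpha> c0 kp V W M f g dt N ns Nr \<xi>h ph p ut \<xi>t u \<xi>"
    and \<xi>L: "\<And>n i. n \<le> N \<Longrightarrow> \<xi> n i \<in> L2 \<Omega>"
    and i: "1 \<le> i"
  shows "(\<Sum>n=2..N. (l2_norm \<Omega> (bdf2 dt (\<lambda>m x. 1 *\<^sub>R \<xi>t m i x + (-1) *\<^sub>R \<xi>h m x) n))\<^sup>2)
    \<le> (1 / ((c0 * lam / \<alpha>\<^sup>2 + 1) * (\<beta>\<^sup>2 / (2 * \<mu>) * lam + 1)))\<^sup>2 * xi_error_sum \<Omega> dt N \<xi> \<xi>h (i - 1)"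
proof -
  let ?ep = "\<lambda>m x. 1 *\<^sub>R p m i x + (-1) *\<^sub>R ph m x"
  let ?et = "\<lambda>m x. 1 *\<^sub>R \<xi>t m i x + (-1) *\<^sub>R \<xi>h m x"
  let ?eu = "\<lambda>m x. 1 *\<^sub>R ut m i x + (-1) *\<^sub>R uh m x"
  let ?z = "\<lambda>n. bdf2 dt (\<lambda>m x. 1 *\<^sub>R \<xi> m (i - 1) x + (-1) *\<^sub>R \<xi>h m x) n"
  note lin = psd_form.lin[OF l2_inner_psd]
  have h01: "\<xi>h 0 \<in> W" "\<xi>h 1 \<in> W" "ph 0 \<in> M" "ph 1 \<in> M"
    using mono by (auto simp: monolithic_bdf2_def)
  have hn: "\<xi>h n \<in> W" "ph n \<in> M"
    "mixed_solution \<Omega> lam \<mu> \<alpha> V W (f (real n * dt)) (ph n) (uh n) (\<xi>h n)"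
    if "n \<in> {2..N}" for n
    using mono that by (auto simp: monolithic_bdf2_def mixed_solution_def)
  have rn: "p n i \<in> M"
    "mixed_solution \<Omega> lam \<mu> \<alpha> V W (f (real n * dt)) (p n i) (ut n i) (\<xi>t n i)"
    if "n \<in> {2..N}" for n
    using rom i that by (auto simp: rom_algorithm_def)
  have r01: "p n i = ph n" "\<xi>t n i = \<xi>h n" if "n < 2" for n
    using rom i that by (auto simp: rom_algorithm_def)
  have two: "n \<in> {2..N} \<or> n = 0 \<or> n = 1" if "n \<le> N" for n using that by auto
  have phM: "ph n \<in> M" and pM: "p n i \<in> M" and \<xi>hW: "\<xi>h n \<in> W" if "n \<le> N" for n
    using two[OF that] h01 hn rn r01[of n] by auto
  have \<xi>hL: "\<xi>h n \<in> L2 \<Omega>" if "n \<le> N" for n using \<xi>hW[OF that] W_L2 by auto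
  have bdf_L2: "bdf2 dt y n \<in> L2 \<Omega>" if "n \<in> {2..N}" "\<And>m. m \<le> N \<Longrightarrow> y m \<in> L2 \<Omega>"
    for n and y :: "nat \<Rightarrow> real^'d \<Rightarrow> real"
    unfolding bdf2_eq_comb using that by (intro L2_comb) auto
  have epM: "?ep n \<in> M" if "n \<le> N" for n
    using that by (intro M_comb phM pM)
  have zL: "?z n \<in> L2 \<Omega>" if "n \<in> {2..N}" for n
    using that by (intro bdf_L2 L2_comb \<xi>L \<xi>hL)
  have pressure_eq: "form_a3 \<Omega> lam \<alpha> c0 (bdf2 dt ?ep n) q + form_d \<Omega> kp (?ep n) q = form_c \<Omega> lam \<alpha> q (?z n)"
    if n: "n \<in> {2..N}" and q: "q \<in> M" for n q
  proof -
    interpret d: real_psd_form "H1 \<Omega>" "form_d \<Omega> kp" using pos by (intro form_d_psd) simp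
    have nN: "n \<le> N" using n by simp
    have bL: "bdf2 dt (\<lambda>m. p m i) n \<in> L2 \<Omega>" "bdf2 dt ph n \<in> L2 \<Omega>"
      "bdf2 dt (\<lambda>m. \<xi> m (i - 1)) n \<in> L2 \<Omega>" "bdf2 dt \<xi>h n \<in> L2 \<Omega>"
      using phM pM M_L2 by (auto intro!: bdf_L2[OF n] \<xi>L \<xi>hL)
    have h: "form_a3 \<Omega> lam \<alpha> c0 (bdf2 dt ph n) q - form_c \<Omega> lam \<alpha> q (bdf2 dt \<xi>h n)
        + form_d \<Omega> kp (ph n) q = l2_inner \<Omega> (g (real n * dt)) q"
      using mono n q by (auto simp: monolithic_bdf2_def)
    have r: "form_a3 \<Omega> lam \<alpha> c0 (bdf2 dt (\<lambda>m. p m i) n) q + form_d \<Omega> kp (p n i) q =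
        l2_inner \<Omega> (g (real n * dt)) q + form_c \<Omega> lam \<alpha> q (bdf2 dt (\<lambda>m. \<xi> m (i - 1)) n)"
      using rom i n q by (auto simp: rom_algorithm_def)
    have "form_a3 \<Omega> lam \<alpha> c0 (bdf2 dt ?ep n) q
        = form_a3 \<Omega> lam \<alpha> c0 (bdf2 dt (\<lambda>m. p m i) n) q - form_a3 \<Omega> lam \<alpha> c0 (bdf2 dt ph n) q"
      unfolding bdf2_diff form_a3_def lin[OF bL(1,2) M_L2[OF q]] by (simp add: algebra_simps)
    moreover have "form_d \<Omega> kp (?ep n) q = form_d \<Omega> kp (p n i) q - form_d \<Omega> kp (ph n) q"
      using d.lin[of "p n i" "ph n" q 1 "-1"] M_H1 phM[OF nN] pM[OF nN] q by auto
    moreover have "form_c \<Omega> lam \<alpha> q (?z n)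
        = form_c \<Omega> lam \<alpha> q (bdf2 dt (\<lambda>m. \<xi> m (i - 1)) n) - form_c \<Omega> lam \<alpha> q (bdf2 dt \<xi>h n)"
      unfolding bdf2_diff form_c_def l2_inner_commute[of \<Omega> q] lin[OF bL(3,4) M_L2[OF q]]
      by (simp add: algebra_simps)
    ultimately show ?thesis using h r by simp
  qed
  have ez: "?ep n = (\<lambda>x. 0)" "?et n = (\<lambda>x. 0)" if "n < 2" for n
    using r01[OF that] by auto
  have P: "(\<Sum>n=2..N. (l2_norm \<Omega> (bdf2 dt ?ep n))\<^sup>2)
    \<le> (1 / (\<alpha> * (c0 * lam / \<alpha>\<^sup>2 + 1)))\<^sup>2 * (\<Sum>n=2..N. (l2_norm \<Omega> (?z n))\<^sup>2)"
    using pos by (intro pressure_error_bound[OF _ _ _ _ _ epM ez(1) zL pressure_eq]) auto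
  have "(l2_norm \<Omega> (bdf2 dt ?et n))\<^sup>2
      \<le> (\<alpha> / (\<beta>\<^sup>2 / (2 * \<mu>) * lam + 1))\<^sup>2 * (l2_norm \<Omega> (bdf2 dt ?ep n))\<^sup>2" if n: "n \<in> {2..N}" for n
  proof -
    have "mixed_solution \<Omega> lam \<mu> \<alpha> V W (\<lambda>x. 0) (?ep n) (?eu n) (?et n)" if n: "n \<in> {2..N}" for n
      using pos n by (intro mixed_solution_comb[OF _ _ _ rn(2)[OF n] hn(3)[OF n]] M_L2 pM phM)
        (auto simp: l2_inner_zero)
    then obtain w where "mixed_solution \<Omega> lam \<mu> \<alpha> V W (\<lambda>x. 0) (bdf2 dt ?ep n) w (bdf2 dt ?et n)"
      using mixed_solution_bdf2[of \<mu> N ?ep lam \<alpha> ?eu ?et n dt] pos n ez epM M_L2 by auto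
    then have "l2_norm \<Omega> (bdf2 dt ?et n) \<le> \<alpha> / (\<beta>\<^sup>2 / (2 * \<mu>) * lam + 1) * l2_norm \<Omega> (bdf2 dt ?ep n)"
      using pos infsup n epM M_L2 by (intro mixed_solution_stable bdf_L2) auto
    then show ?thesis
      unfolding power_mult_distrib[symmetric] by (intro power_mono l2_norm_nonneg)
  qed
  then have "(\<Sum>n=2..N. (l2_norm \<Omega> (bdf2 dt ?et n))\<^sup>2)
      \<le> (\<alpha> / (\<beta>\<^sup>2 / (2 * \<mu>) * lam + 1))\<^sup>2 * (\<Sum>n=2..N. (l2_norm \<Omega> (bdf2 dt ?ep n))\<^sup>2)"
    unfolding sum_distrib_left by (intro sum_mono)
  also have "\<dots> \<le> (\<alpha> / (\<beta>\<^sup>2 / (2 * \<mu>) * lam + 1))\<^sup>2 *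
      ((1 / (\<alpha> * (c0 * lam / \<alpha>\<^sup>2 + 1)))\<^sup>2 * (\<Sum>n=2..N. (l2_norm \<Omega> (?z n))\<^sup>2))"
    by (intro mult_left_mono P) auto
  also have "\<dots> = (1 / ((c0 * lam / \<alpha>\<^sup>2 + 1) * (\<beta>\<^sup>2 / (2 * \<mu>) * lam + 1)))\<^sup>2 * (\<Sum>n=2..N. (l2_norm \<Omega> (?z n))\<^sup>2)"
    using pos unfolding mult.assoc[symmetric] power_mult_distrib[symmetric]
    by (simp add: mult.commute)
  also have "(\<Sum>n=2..N. (l2_norm \<Omega> (?z n))\<^sup>2) = xi_error_sum \<Omega> dt N \<xi> \<xi>h (i - 1)"
    using rom by (subst xi_error_sum_def, subst xi_error_eq) (auto simp: rom_algorithm_def)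
  finally show ?thesis .
qed

text \<open>The error of the reduced iterate splits into that of the full-order solution, which contracts by
  \<open>K\<close>, and the projection error, whose BDF-2 quotient has squared norm at most \<open>16 \<epsilon> / \<Delta>t\<^sup>2\<close> at each of the
  \<open>N - 1\<close> time levels.\<close>

lemma rom_error_recursion:
  assumes pos: "0 < lam" "0 < \<mu>" "0 < \<alpha>" "0 \<le> c0" "0 < kp" "0 < \<beta>" "0 < dt"
    and N: "2 \<le> N"
    and infsup: "inf_sup_condition \<Omega> V W \<beta>"
    and ns: "set ns \<subseteq> {2..N}" "Nr < length ns"
    and mono: "monolithic_bdf2 \<Omega> lam \<mu> \<alpha> c0 kp V W M f g dt N uh \<xi>h ph"
    and rom: "rom_algorithm \<Omega> lam \<mu> \<alpha> c0 kp V W M f g dt N ns Nr \<xi>h ph p ut \<xi>t u \<xi>"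
    and i: "1 \<le> i"
    and K: "K = 1 / ((c0 * lam / \<alpha>\<^sup>2 + 1) * (\<beta>\<^sup>2 / (2 * \<mu>) * lam + 1))"
  shows "xi_error_sum \<Omega> dt N \<xi> \<xi>h i
    \<le> 16 * real (N - 1) / dt\<^sup>2 * ((1 + K\<^sup>2) / (1 - K\<^sup>2)) * eps_ROM \<Omega> N \<xi> \<xi>t i
      + (1 + K\<^sup>2) / 2 * xi_error_sum \<Omega> dt N \<xi> \<xi>h (i - 1)" (is "?S i \<le> _")
    and "0 < K" "K < 1"
proof -
  have gt1: "1 < x * y" if "1 \<le> x" "1 < y" for x y :: real
    using mult_right_mono[of 1 x y] that by linarith
  have "1 < (c0 * lam / \<alpha>\<^sup>2 + 1) * (\<beta>\<^sup>2 / (2 * \<mu>) * lam + 1)"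
    using pos by (intro gt1) auto
  then show K01: "0 < K" "K < 1" by (auto simp: K)
  then have K2: "0 < K\<^sup>2" "K\<^sup>2 < 1" by (auto simp: power_less_one_iff)
  have W_snap: "\<xi>t n j \<in> W" if "1 \<le> j" "n \<in> {2..N}" for n j
    using rom that by (auto simp: rom_algorithm_def mixed_solution_def)
  have \<xi>W: "\<xi> n j \<in> W" if "n \<le> N" for n j
  proof -
    consider "n < 2" | "n \<in> {2..N}" "j = 0" | "n \<in> {2..N}" "1 \<le> j" using \<open>n \<le> N\<close> by force
    then show ?thesis
    proof cases
      case 1
      then have "n = 0 \<or> n = 1" by auto
      then show ?thesis using 1 rom mono by (auto simp: rom_algorithm_def monolithic_bdf2_def)
    next
      case 2
      then show ?thesis using rom by (auto simp: rom_algorithm_def)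
    next
      case 3
      then obtain Vr Wr where pod: "is_pod_space (l2_inner \<Omega>) (length ns) (\<lambda>\<beta>. \<xi>t (ns ! \<beta>) j) Nr Wr"
        and sol: "mixed_solution \<Omega> lam \<mu> \<alpha> Vr Wr (f (real n * dt)) (p n j) (u n j) (\<xi> n j)"
        using rom unfolding rom_algorithm_def by meson
      have "Wr \<subseteq> W"
        using ns 3 by (intro is_pod_space_subset[OF W_comb pod] W_snap) (auto simp: subset_iff)
      then show ?thesis using sol by (auto simp: mixed_solution_def)
    qed
  qed
  then have \<xi>L: "\<xi> n j \<in> L2 \<Omega>" if "n \<le> N" for n j using W_L2 that by blast
  have \<xi>tL: "\<xi>t n i \<in> L2 \<Omega>" "\<xi>h n \<in> L2 \<Omega>" if "n \<le> N" for n
  proof -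
    consider "n < 2" | "n \<in> {2..N}" using \<open>n \<le> N\<close> by force
    then have "\<xi>t n i \<in> W \<and> \<xi>h n \<in> W"
    proof cases
      case 1
      then have "n = 0 \<or> n = 1" by auto
      then show ?thesis using 1 i rom mono by (auto simp: rom_algorithm_def monolithic_bdf2_def)
    next
      case 2
      then show ?thesis using W_snap[OF i 2] mono by (auto simp: monolithic_bdf2_def)
    qed
    then show "\<xi>t n i \<in> L2 \<Omega>" "\<xi>h n \<in> L2 \<Omega>" using W_L2 by auto
  qed
  let ?et = "\<lambda>m x. 1 *\<^sub>R \<xi>t m i x + (-1) *\<^sub>R \<xi>h m x"
  let ?er = "\<lambda>m x. 1 *\<^sub>R \<xi> m i x + (-1) *\<^sub>R \<xi>t m i x"
  let ?\<epsilon> = "eps_ROM \<Omega> N \<xi> \<xi>t i"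
  interpret l2: real_psd_form "L2 \<Omega>" "l2_inner \<Omega> :: (real^'d \<Rightarrow> real) \<Rightarrow> _"
    by (rule l2_inner_real_psd)
  have err: "l2_inner \<Omega> (?er n) (?er n) \<le> ?\<epsilon>" if "n \<in> {2..N}" for n
    using that unfolding eps_ROM_def l2_norm_power2 by (intro Max_ge) auto
  have \<epsilon>: "0 \<le> ?\<epsilon>"
    using err[of 2] N l2.nonneg[OF L2_comb[OF \<xi>L[of 2 i] \<xi>tL(1)[of 2], of 1 "-1"]] by simp
  have err': "l2_inner \<Omega> (?er n) (?er n) \<le> ?\<epsilon>" if "n \<le> N" for n
  proof (cases "n < 2")
    case True
    then have "\<xi> n i = \<xi>t n i" using rom i by (auto simp: rom_algorithm_def)
    then show ?thesis using \<epsilon> by (simp add: l2_inner_zero)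
  qed (use err that in auto)
  \<comment> \<open>The solution of \<open>(1 + t) K\<^sup>2 = (1 + K\<^sup>2) / 2\<close>.\<close>
  define t where "t = (1 - K\<^sup>2) / (2 * K\<^sup>2)"
  have t: "0 < t" "(1 + t) * K\<^sup>2 = (1 + K\<^sup>2) / 2" "1 + 1 / t = (1 + K\<^sup>2) / (1 - K\<^sup>2)"
    using K2 by (auto simp: t_def field_simps)
  have "(l2_norm \<Omega> (bdf2 dt (\<lambda>m. xi_error \<xi> \<xi>h m i) n))\<^sup>2
      \<le> (1 + t) * (l2_norm \<Omega> (bdf2 dt ?et n))\<^sup>2 + (1 + 1 / t) * (16 * ?\<epsilon> / dt\<^sup>2)"
    if n: "n \<in> {2..N}" for n
  proof -
    have er: "?er m \<in> L2 \<Omega>" if "m \<le> N" for m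
      using that by (intro L2_comb \<xi>L \<xi>tL)
    have et: "?et m \<in> L2 \<Omega>" if "m \<le> N" for m
      using that by (intro L2_comb \<xi>tL)
    have bL: "bdf2 dt ?et n \<in> L2 \<Omega>" "bdf2 dt ?er n \<in> L2 \<Omega>"
      using n by (auto intro!: l2.bdf2_closed er et simp only: atLeastAtMost_iff)
    have "bdf2 dt (\<lambda>m. xi_error \<xi> \<xi>h m i) n = (\<lambda>x. bdf2 dt ?et n x + bdf2 dt ?er n x)"
      using rom by (subst xi_error_eq) (auto simp: rom_algorithm_def bdf2_def fun_eq_iff algebra_simps)
    then have "(l2_norm \<Omega> (bdf2 dt (\<lambda>m. xi_error \<xi> \<xi>h m i) n))\<^sup>2
        \<le> (1 + t) * (l2_norm \<Omega> (bdf2 dt ?et n))\<^sup>2 + (1 + 1 / t) * l2_inner \<Omega> (bdf2 dt ?er n) (bdf2 dt ?er n)"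
      unfolding l2_norm_power2 using l2.norm_add_young[OF bL t(1)] by simp
    also have "l2_inner \<Omega> (bdf2 dt ?er n) (bdf2 dt ?er n) \<le> 16 * ?\<epsilon> / dt\<^sup>2"
      using n pos by (intro l2.bdf2_norm_bound er err') auto
    finally show ?thesis using t(1) by (simp add: mult_left_mono)
  qed
  then have "?S i \<le> (\<Sum>n=2..N. (1 + t) * (l2_norm \<Omega> (bdf2 dt ?et n))\<^sup>2 + (1 + 1 / t) * (16 * ?\<epsilon> / dt\<^sup>2))"
    unfolding xi_error_sum_def by (intro sum_mono)
  also have "\<dots> = (1 + t) * (\<Sum>n=2..N. (l2_norm \<Omega> (bdf2 dt ?et n))\<^sup>2) + real (N - 1) * ((1 + 1 / t) * (16 * ?\<epsilon> / dt\<^sup>2))"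
    by (simp add: sum.distrib sum_distrib_left)
  also have "\<dots> \<le> (1 + t) * (K\<^sup>2 * ?S (i - 1)) + real (N - 1) * ((1 + 1 / t) * (16 * ?\<epsilon> / dt\<^sup>2))"
    using t(1) unfolding K
    by (intro add_right_mono mult_left_mono full_order_contraction[OF pos infsup mono rom \<xi>L i]) auto
  also have "\<dots> = 16 * real (N - 1) / dt\<^sup>2 * ((1 + K\<^sup>2) / (1 - K\<^sup>2)) * ?\<epsilon> + (1 + K\<^sup>2) / 2 * ?S (i - 1)"
    unfolding t(2,3)[symmetric] by simp
  finally show "?S i \<le> \<dots>" .
qed

end

section \<open>Perturbed contractions\<close>

text \<open>The number \<open>E / (1 - r)\<close> is the fixed point of \<open>s \<mapsto> E + r s\<close>; the excess over it
  shrinks at least by the factor \<open>r\<close> in each step.\<close>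

lemma perturbed_contraction_bound:
  fixes S :: "nat \<Rightarrow> real"
  assumes r: "0 \<le> r" "r < 1" and step: "\<And>i. 1 \<le> i \<Longrightarrow> S i \<le> E + r * S (i - 1)"
  shows "S i \<le> E / (1 - r) + r ^ i * (S 0 - E / (1 - r))"
proof (induction i)
  case (Suc i)
  have "S (Suc i) \<le> E + r * S i" using step[of "Suc i"] by simp
  also have "\<dots> \<le> E + r * (E / (1 - r) + r ^ i * (S 0 - E / (1 - r)))"
    using Suc r by (intro add_left_mono mult_left_mono) auto
  also have "E + r * (E / (1 - r) + r ^ i * (S 0 - E / (1 - r)))
      = E / (1 - r) + r ^ Suc i * (S 0 - E / (1 - r))"
  proof -
    have "(1 - r) * (E / (1 - r)) = E"
      using r by simp
    then have "E = E / (1 - r) - r * (E / (1 - r))"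
      by (simp only: left_diff_distrib mult_1)
    then show ?thesis by (simp add: algebra_simps del: times_divide_eq_right times_divide_eq_left)
  qed
  finally show ?case .
qed simp

lemma perturbed_contraction_limsup:
  fixes S :: "nat \<Rightarrow> real"
  assumes r: "0 \<le> r" "r < 1" and step: "\<And>i. 1 \<le> i \<Longrightarrow> S i \<le> E + r * S (i - 1)"
  shows "limsup (\<lambda>i. ereal (S i)) \<le> ereal (E / (1 - r))"
    and "S \<longlonglongrightarrow> s \<Longrightarrow> s \<le> E / (1 - r)"
proof -
  let ?L = "E / (1 - r)"
  have "(\<lambda>i. ?L + r ^ i * (S 0 - ?L)) \<longlonglongrightarrow> ?L + 0 * (S 0 - ?L)"
    using r by (intro tendsto_intros LIMSEQ_power_zero) auto
  then have lim: "(\<lambda>i. ?L + r ^ i * (S 0 - ?L)) \<longlonglongrightarrow> ?L" by simp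
  have "limsup (\<lambda>i. ereal (S i)) \<le> limsup (\<lambda>i. ereal (?L + r ^ i * (S 0 - ?L)))"
    using perturbed_contraction_bound[where S = S and r = r and E = E, OF r step] by (intro Limsup_mono always_eventually) simp
  also have "\<dots> = ereal ?L"
    using lim by (intro lim_imp_Limsup) (auto simp: tendsto_ereal)
  finally show "limsup (\<lambda>i. ereal (S i)) \<le> ereal ?L" .
  show "s \<le> ?L" if "S \<longlonglongrightarrow> s"
    using that lim perturbed_contraction_bound[where S = S and r = r and E = E, OF r step] by (intro LIMSEQ_le[OF that lim]) auto
qed

theorem theorem4p1:
  assumes "CARD('d::finite) = 2 \<or> CARD('d) = 3"
  shows "\<exists>(C :: real \<Rightarrow> real \<Rightarrow> real) (C1 :: real \<Rightarrow> nat \<Rightarrow> real \<Rightarrow> real) (C2 :: real \<Rightarrow> nat \<Rightarrow> real \<Rightarrow> real).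
    (\<forall>\<beta> \<mu>. 0 < \<beta> \<longrightarrow> 0 < \<mu> \<longrightarrow> 0 < C \<beta> \<mu>) \<and>
    (\<forall>(\<Omega> :: (real^'d) set) \<Gamma>u \<Gamma>\<sigma> \<Gamma>p \<Gamma>q \<T> (k :: nat) (l :: nat)
       (lam :: real) (\<mu> :: real) (\<alpha> :: real) (c0 :: real) (kp :: real) (\<beta> :: real)
       (T :: real) (N :: nat) (\<Delta>t :: real)
       (f :: real \<Rightarrow> real^'d \<Rightarrow> real^'d) (g :: real \<Rightarrow> real^'d \<Rightarrow> real)
       (ns :: nat list) (Nr :: nat)
       (uh :: nat \<Rightarrow> real^'d \<Rightarrow> real^'d) (\<xi>h :: nat \<Rightarrow> real^'d \<Rightarrow> real) (ph :: nat \<Rightarrow> real^'d \<Rightarrow> real)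
       (p :: nat \<Rightarrow> nat \<Rightarrow> real^'d \<Rightarrow> real)
       (ut :: nat \<Rightarrow> nat \<Rightarrow> real^'d \<Rightarrow> real^'d) (\<xi>t :: nat \<Rightarrow> nat \<Rightarrow> real^'d \<Rightarrow> real)
       (u :: nat \<Rightarrow> nat \<Rightarrow> real^'d \<Rightarrow> real^'d) (\<xi> :: nat \<Rightarrow> nat \<Rightarrow> real^'d \<Rightarrow> real).
      polyhedral_domain \<Omega> \<longrightarrow>
      boundary_partition \<Omega> \<Gamma>u \<Gamma>\<sigma> \<longrightarrow> boundary_partition \<Omega> \<Gamma>p \<Gamma>q \<longrightarrow>
      simplicial_mesh \<Omega> \<T> \<longrightarrow> 2 \<le> k \<longrightarrow> 1 \<le> l \<longrightarrow>
      0 < lam \<longrightarrow> 0 < \<mu> \<longrightarrow> 0 < \<alpha> \<longrightarrow> 0 \<le> c0 \<longrightarrow> 0 < kp \<longrightarrow>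
      0 < T \<longrightarrow> 2 \<le> N \<longrightarrow> \<Delta>t = T / real N \<longrightarrow>
      (\<forall>t\<in>{0..T}. f t \<in> L2 \<Omega> \<and> g t \<in> L2 \<Omega>) \<longrightarrow>
      0 < \<beta> \<longrightarrow> inf_sup_condition \<Omega> (Vh \<Omega> \<Gamma>u \<T> k) (Wh \<Omega> \<T> k) \<beta> \<longrightarrow>
      distinct ns \<longrightarrow> set ns \<subseteq> {2..N} \<longrightarrow> Nr < length ns \<longrightarrow>
      monolithic_bdf2 \<Omega> lam \<mu> \<alpha> c0 kp (Vh \<Omega> \<Gamma>u \<T> k) (Wh \<Omega> \<T> k) (Mh \<Omega> \<Gamma>p \<T> l)
        f g \<Delta>t N uh \<xi>h ph \<longrightarrow>
      rom_algorithm \<Omega> lam \<mu> \<alpha> c0 kp (Vh \<Omega> \<Gamma>u \<T> k) (Wh \<Omega> \<T> k) (Mh \<Omega> \<Gamma>p \<T> l)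
        f g \<Delta>t N ns Nr \<xi>h ph p ut \<xi>t u \<xi> \<longrightarrow>
      (let K = 1 / ((c0 * lam / \<alpha>\<^sup>2 + 1) * (C \<beta> \<mu> * lam + 1));
           S = xi_error_sum \<Omega> \<Delta>t N \<xi> \<xi>h;
           \<epsilon> = eps_ROM \<Omega> N \<xi> \<xi>t
       in (\<forall>i\<ge>1. S i \<le> C1 K N \<Delta>t * \<epsilon> i + (1 + K\<^sup>2) / 2 * S (i - 1)) \<and>
          (bdd_above (\<epsilon> ` {1..}) \<longrightarrow>
             limsup (\<lambda>i. ereal (S i)) \<le> ereal (C2 K N \<Delta>t * (SUP i\<in>{1..}. \<epsilon> i)) \<and>
             (\<forall>s. S \<longlonglongrightarrow> s \<longrightarrow> s \<le> C2 K N \<Delta>t * (SUP i\<in>{1..}. \<epsilon> i)))))"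
proof -
  \<comment> \<open>The constant \<open>C\<close> comes from the inf-sup lower bound of the elastic energy; \<open>C2\<close> is the geometric
    series of \<open>C1\<close> with ratio \<open>(1 + K\<^sup>2) / 2\<close>.\<close>
  define C where "C \<beta> \<mu> = \<beta>\<^sup>2 / (2 * \<mu>)" for \<beta> \<mu> :: real
  define C1 where "C1 K N \<Delta>t = 16 * real (N - 1) / \<Delta>t\<^sup>2 * ((1 + K\<^sup>2) / (1 - K\<^sup>2))"
    for K \<Delta>t :: real and N :: nat
  define C2 where "C2 K N \<Delta>t = C1 K N \<Delta>t * (2 / (1 - K\<^sup>2))" for K \<Delta>t :: real and N :: nat
  show ?thesis
  proof (rule exI[of _ C], rule exI[of _ C1], rule exI[of _ C2], intro conjI allI impI, goal_cases)
    case (1 \<beta> \<mu>)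
    then show ?case by (simp add: C_def)
  next
    case (2 \<Omega> \<Gamma>u \<Gamma>\<sigma> \<Gamma>p \<Gamma>q \<T> k l lam \<mu> \<alpha> c0 kp \<beta> T N \<Delta>t f g ns Nr uh \<xi>h ph p ut \<xi>t u \<xi>)
    interpret bounded_open_set \<Omega>
      using 2 by unfold_locales (auto simp: polyhedral_domain_def)
    interpret discrete_spaces \<Omega> "Vh \<Omega> \<Gamma>u \<T> k" "Wh \<Omega> \<T> k" "Mh \<Omega> \<Gamma>p \<T> l"
      by unfold_locales (auto simp only: intro: Vh_comb Wh_comb Mh_comb, auto simp: Vh_def Wh_def Mh_def)
    define K where "K = 1 / ((c0 * lam / \<alpha>\<^sup>2 + 1) * (C \<beta> \<mu> * lam + 1))"
    let ?S = "xi_error_sum \<Omega> \<Delta>t N \<xi> \<xi>h" and ?\<epsilon> = "eps_ROM \<Omega> N \<xi> \<xi>t"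
    have "0 < \<Delta>t" using 2 by simp
    note rec = rom_error_recursion[where lam = lam and \<mu> = \<mu> and \<alpha> = \<alpha> and ?c0.0 = c0 and kp = kp
        and \<beta> = \<beta> and dt = \<Delta>t and N = N and ns = ns and Nr = Nr and f = f and g = g and uh = uh
        and \<xi>h = \<xi>h and ph = ph and p = p and ut = ut and \<xi>t = \<xi>t and u = u and \<xi> = \<xi>,
        OF 2(7-11) 2(16) \<open>0 < \<Delta>t\<close> 2(13,17,19,20,21,22) _ K_def[unfolded C_def]]
    have K: "0 < K\<^sup>2" "K\<^sup>2 < 1"
      using rec(2,3)[OF order_refl] by (auto simp: power_less_one_iff)
    have step: "?S i \<le> C1 K N \<Delta>t * ?\<epsilon> i + (1 + K\<^sup>2) / 2 * ?S (i - 1)" if "1 \<le> i" for i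
      unfolding C1_def using rec(1)[OF that] .
    have C1: "0 \<le> C1 K N \<Delta>t" using K by (simp add: C1_def)
    have lim: "limsup (\<lambda>i. ereal (?S i)) \<le> ereal (C2 K N \<Delta>t * (SUP i\<in>{1..}. ?\<epsilon> i))"
      "\<And>s. ?S \<longlonglongrightarrow> s \<Longrightarrow> s \<le> C2 K N \<Delta>t * (SUP i\<in>{1..}. ?\<epsilon> i)"
      if bdd: "bdd_above (?\<epsilon> ` {1..})"
    proof -
      let ?E = "C1 K N \<Delta>t * (SUP i\<in>{1..}. ?\<epsilon> i)"
      have "?S i \<le> ?E + (1 + K\<^sup>2) / 2 * ?S (i - 1)" if "1 \<le> i" for i
      proof -
        have "C1 K N \<Delta>t * ?\<epsilon> i \<le> ?E"
          using that by (intro mult_left_mono C1 cSUP_upper bdd) auto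
        then show ?thesis using step[OF that] by linarith
      qed
      moreover have "0 \<le> (1 + K\<^sup>2) / 2" "(1 + K\<^sup>2) / 2 < 1" using K by auto
      moreover have "?E / (1 - (1 + K\<^sup>2) / 2) = C2 K N \<Delta>t * (SUP i\<in>{1..}. ?\<epsilon> i)"
        using K by (simp add: C2_def field_simps)
      ultimately show "limsup (\<lambda>i. ereal (?S i)) \<le> ereal (C2 K N \<Delta>t * (SUP i\<in>{1..}. ?\<epsilon> i))"
        "\<And>s. ?S \<longlonglongrightarrow> s \<Longrightarrow> s \<le> C2 K N \<Delta>t * (SUP i\<in>{1..}. ?\<epsilon> i)"
        using perturbed_contraction_limsup[of "(1 + K\<^sup>2) / 2" ?S ?E] by auto
    qed
    show ?case
      unfolding Let_def K_def[symmetric] using step lim by blast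
  qed
qed

end
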